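(* Let a snapshot matrix $X_s \in \mathbb{R}^{2n \times n_s}$ be given, and augment it with "rotated" snapshots to $Y_s = [X_s \;\; \mathbb{J}_{2n} X_s] \in \mathbb{R}^{2n \times 2n_s}$. Assume that $2k$ is such that there is a gap in the singular values of $Y_s$, i.e. $\sigma_{2k}(Y_s) > \sigma_{2k+1}(Y_s)$. Then minimizing the PSD in the set of symplectic, orthonormal matrices (reduced-order bases) $V \in \mathbb{R}^{2n\times 2k}$ is equivalent to the following minimization problem: $$\underset{V \in \mathbb{R}^{2n \times 2k}}{\text{minimize}} \; \left\|(I_{2n} - V V^{\mathsf T}) [X_s \;\; \mathbb{J}_{2n} X_s]\right\|_F^2 \quad \text{subject to } V^{\mathsf T} V = I_{2k}.$$ This is equivalent to the POD applied to the snapshot matrix $Y_s$, and the procedure is therefore called the POD of $Y_s$. A minimizer can be derived with the singular value decomposition (SVD), as is common for POD.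
   Context: $n, n_s, k$ are positive integers with $k \le n$. $\mathbb{J}_{2m} = \begin{bmatrix} 0 & I_m \\ -I_m & 0\end{bmatrix} \in \mathbb{R}^{2m\times 2m}$ denotes the Poisson matrix. A matrix $V \in \mathbb{R}^{2n\times 2k}$ is symplectic if $V^{\mathsf T}\mathbb{J}_{2n}V = \mathbb{J}_{2k}$; its symplectic inverse is $V^{+} = \mathbb{J}_{2k}^{\mathsf T} V^{\mathsf T} \mathbb{J}_{2n}$. It is symplectic, orthonormal if additionally $V^{\mathsf T}V = I_{2k}$. $\|\cdot\|_F$ is the Frobenius norm and $\sigma_1(Y_s)\ge\sigma_2(Y_s)\ge\dots$ are the singular values of $Y_s$ in descending order. PSD (Proper Symplectic Decomposition) for the snapshot matrix $X_s$: minimize $\|(I_{2n} - V V^{+}) X_s\|_F^2$ over $V \in \mathbb{R}^{2n\times 2k}$ subject to $V^{\mathsf T}\mathbb{J}_{2n}V = \mathbb{J}_{2k}$. Minimizing the PSD in the set of symplectic, orthonormal matrices means minimizing the same functional subject to both $V^{\mathsf T}\mathbb{J}_{2n}V = \mathbb{J}_{2k}$ and $V^{\mathsf T}V = I_{2k}$. POD (Proper Orthogonal Decomposition) for a snapshot matrix with columns $y_1,\dots,y_N \in \mathbb{R}^{2n}$: minimize $\sum_{i=1}^{N} \|(I_{2n} - V V^{\mathsf T}) y_i\|_2^2$ over $V \in \mathbb{R}^{2n\times 2k}$ subject to $V^{\mathsf T}V = I_{2k}$. *)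

theory Defs
  imports Complex_Main "Jordan_Normal_Form.Char_Poly"
begin

(* poisson_mat m is the 2m x 2m matrix J_{2m}. *)
definition poisson_mat :: "nat \<Rightarrow> real mat" where
  "poisson_mat m = four_block_mat (0\<^sub>m m m) (1\<^sub>m m) (- (1\<^sub>m m)) (0\<^sub>m m m)"

(* In the following definitions n and k are half the numbers of rows and columns of V. *)
definition symplectic_mat :: "nat \<Rightarrow> nat \<Rightarrow> real mat \<Rightarrow> bool" where
  "symplectic_mat n k V \<longleftrightarrow>
     V \<in> carrier_mat (2 * n) (2 * k) \<and>
     transpose_mat V * poisson_mat n * V = poisson_mat k"

definition symplectic_inverse :: "nat \<Rightarrow> nat \<Rightarrow> real mat \<Rightarrow> real mat" where
  "symplectic_inverse n k V = transpose_mat (poisson_mat k) * transpose_mat V * poisson_mat n"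

(* The library predicate orthogonal_mat only asks for nonzero, pairwise orthogonal columns,
   hence the separate notion. *)
definition orthonormal_cols :: "nat \<Rightarrow> nat \<Rightarrow> real mat \<Rightarrow> bool" where
  "orthonormal_cols r c V \<longleftrightarrow> V \<in> carrier_mat r c \<and> transpose_mat V * V = 1\<^sub>m c"

definition frob_norm :: "real mat \<Rightarrow> real" where
  "frob_norm A = sqrt (\<Sum>i<dim_row A. \<Sum>j<dim_col A. (A $$ (i, j))\<^sup>2)"

definition euclid_norm :: "real vec \<Rightarrow> real" where
  "euclid_norm v = sqrt (v \<bullet> v)"

(* Square roots of the eigenvalues of A^T A, with multiplicity and in descending order,
   continued by zeros.  Indices start at 1. *)
definition singular_value :: "real mat \<Rightarrow> nat \<Rightarrow> real" where
  "singular_value A i =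
     (if 1 \<le> i \<and> i \<le> dim_col A
      then sqrt (rev (sorted_list_of_multiset (proots (char_poly (transpose_mat A * A)))) ! (i - 1))
      else 0)"

(* Full singular value decomposition A = U S W^T with square U and W and ordered singular values. *)
definition is_svd :: "real mat \<Rightarrow> real mat \<Rightarrow> real mat \<Rightarrow> real mat \<Rightarrow> bool" where
  "is_svd A U S W \<longleftrightarrow>
     orthonormal_cols (dim_row A) (dim_row A) U \<and>
     orthonormal_cols (dim_col A) (dim_col A) W \<and>
     S \<in> carrier_mat (dim_row A) (dim_col A) \<and>
     diagonal_mat S \<and>
     (\<forall>i < min (dim_row A) (dim_col A). S $$ (i, i) = singular_value A (i + 1)) \<and>
     A = U * S * transpose_mat W"

definition append_cols :: "real mat \<Rightarrow> real mat \<Rightarrow> real mat" where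
  "append_cols A B = mat_of_cols (dim_row A) (cols A @ cols B)"

definition first_cols :: "nat \<Rightarrow> real mat \<Rightarrow> real mat" where
  "first_cols c A = mat_of_cols (dim_row A) (take c (cols A))"

definition rotated_augmentation :: "nat \<Rightarrow> real mat \<Rightarrow> real mat" where
  "rotated_augmentation n X = append_cols X (poisson_mat n * X)"

definition psd_orthonormal_minimizer :: "nat \<Rightarrow> nat \<Rightarrow> real mat \<Rightarrow> real mat \<Rightarrow> bool" where
  "psd_orthonormal_minimizer n k X =
     is_arg_min (\<lambda>V. (frob_norm ((1\<^sub>m (2 * n) - V * symplectic_inverse n k V) * X))\<^sup>2)
       (\<lambda>V. symplectic_mat n k V \<and> orthonormal_cols (2 * n) (2 * k) V)"

definition projection_minimizer :: "nat \<Rightarrow> nat \<Rightarrow> real mat \<Rightarrow> real mat \<Rightarrow> bool" where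
  "projection_minimizer n k Y =
     is_arg_min (\<lambda>V. (frob_norm ((1\<^sub>m (2 * n) - V * transpose_mat V) * Y))\<^sup>2)
       (orthonormal_cols (2 * n) (2 * k))"

definition pod_minimizer :: "nat \<Rightarrow> nat \<Rightarrow> real mat \<Rightarrow> real mat \<Rightarrow> bool" where
  "pod_minimizer n k Y =
     is_arg_min (\<lambda>V. \<Sum>y\<leftarrow>cols Y. (euclid_norm ((1\<^sub>m (2 * n) - V * transpose_mat V) *\<^sub>v y))\<^sup>2)
       (orthonormal_cols (2 * n) (2 * k))"

end

theory Submission
  imports Defs
begin

text \<open>
Write \<^term>\<open>J\<close> for the Poisson matrix, \<^term>\<open>r\<close> for twice \<^term>\<open>k\<close>, and \<^term>\<open>P\<close> for the
orthogonal projector \<^term>\<open>V * transpose_mat V\<close> of a matrix \<^term>\<open>V\<close> with orthonormal columns.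

The projection error of \<^term>\<open>Y\<close> depends on \<^term>\<open>V\<close> only through \<^term>\<open>P\<close>. Expanded in the left
singular vectors of \<^term>\<open>Y\<close> it is the sum of the squared singular values with weights in \<open>[0, 1]\<close>
whose total is fixed by the rank of \<^term>\<open>P\<close>. Moving all the weight to the small singular values
minimises the sum, and the gap makes this the only choice. So the minimisers are exactly the
orthonormal bases of one subspace, spanned by the leading left singular vectors
(\<open>projection_error_minimum\<close>).

The augmented matrix has, up to signs and order, the same columns after a rotation by
\<^term>\<open>J\<close>. Hence \<^term>\<open>J * V\<close> is a minimiser whenever \<^term>\<open>V\<close> is, and by uniqueness the optimal
subspace is invariant under \<^term>\<open>J\<close>. On an invariant subspace \<^term>\<open>J\<close> acts as a skew-symmetric
orthogonal matrix, and such a matrix has an orthonormal Darboux basis. Therefore every minimiser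
becomes symplectic after a rotation of its columns (\<open>symplectic_basis_of_invariant_subspace\<close>).

Conversely, a symplectic matrix with orthonormal columns intertwines the Poisson matrices of the
large and the small space, so that its symplectic inverse is its transpose and its projector
commutes with \<^term>\<open>J\<close>. The two halves of the augmented matrix then contribute equally, and the
symplectic error of \<^term>\<open>X\<close> is half the projection error of \<^term>\<open>Y\<close>
(\<open>psd_error_eq_half_projection_error\<close>). Since the unconstrained minimum is attained at a symplectic
matrix, the symplectic minimisers are precisely the symplectic ones among all minimisers.

The existence of a singular value decomposition rests on the spectral theorem for real symmetric
matrices.
\<close>

text \<open>
A column of a product is to be simplified to a matrix applied to a column, never to a vector of
inner products: orthonormality arguments need the former.
\<close>

declare col_mult [simp del]

section \<open>Orthonormal families of real vectors\<close>

lemma real_scalar_prod_ge_0: "0 \<le> (v :: real vec) \<bullet> v"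
  by (auto simp: scalar_prod_def intro!: sum_nonneg)

lemma real_scalar_prod_self_eq_0:
  assumes "(v :: real vec) \<in> carrier_vec n"
  shows "v \<bullet> v = 0 \<longleftrightarrow> v = 0\<^sub>v n"
proof
  assume "v \<bullet> v = 0"
  then have "\<forall>i<n. v $ i = 0"
    using assms by (auto simp: scalar_prod_def sum_nonneg_eq_0_iff)
  then show "v = 0\<^sub>v n" using assms by auto
qed (auto simp: scalar_prod_def)

lemma scalar_prod_smult:
  fixes u v :: "real vec"
  assumes "u \<in> carrier_vec n" "v \<in> carrier_vec n"
  shows "(a \<cdot>\<^sub>v u) \<bullet> (b \<cdot>\<^sub>v v) = a * b * (u \<bullet> v)"
  using assms by simp

lemma exists_unit_multiple:
  fixes v :: "real vec"
  assumes "v \<in> carrier_vec n" "v \<noteq> 0\<^sub>v n"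
  obtains c where "(c \<cdot>\<^sub>v v) \<bullet> (c \<cdot>\<^sub>v v) = 1"
proof
  have "v \<bullet> v > 0"
    using real_scalar_prod_ge_0[of v] real_scalar_prod_self_eq_0[OF assms(1)] assms(2) by linarith
  then show "(1 / sqrt (v \<bullet> v) \<cdot>\<^sub>v v) \<bullet> (1 / sqrt (v \<bullet> v) \<cdot>\<^sub>v v) = 1"
    using assms(1) by (simp add: scalar_prod_smult)
qed

lemma symmetric_mat_scalar_prod:
  fixes A :: "real mat"
  assumes "A \<in> carrier_mat n n" "transpose_mat A = A" "u \<in> carrier_vec n" "v \<in> carrier_vec n"
  shows "u \<bullet> (A *\<^sub>v v) = (A *\<^sub>v u) \<bullet> v"
  using transpose_vec_mult_scalar[of A n n v u] assms by simp

lemma orthonormal_cols_iff_col: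
  assumes "V \<in> carrier_mat r c"
  shows "orthonormal_cols r c V \<longleftrightarrow>
    (\<forall>i<c. \<forall>j<c. col V i \<bullet> col V j = (if i = j then 1 else 0))"
proof -
  have "transpose_mat V * V = 1\<^sub>m c \<longleftrightarrow> (\<forall>i<c. \<forall>j<c. (transpose_mat V * V) $$ (i,j) = 1\<^sub>m c $$ (i,j))"
  proof
    assume "transpose_mat V * V = 1\<^sub>m c"
    then show "\<forall>i<c. \<forall>j<c. (transpose_mat V * V) $$ (i,j) = 1\<^sub>m c $$ (i,j)" by simp
  next
    assume "\<forall>i<c. \<forall>j<c. (transpose_mat V * V) $$ (i,j) = 1\<^sub>m c $$ (i,j)"
    then show "transpose_mat V * V = 1\<^sub>m c" using assms by (intro eq_matI) auto
  qed
  also have "\<dots> \<longleftrightarrow> (\<forall>i<c. \<forall>j<c. col V i \<bullet> col V j = (if i = j then 1 else 0))"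
    using assms by simp
  finally show ?thesis using assms by (simp add: orthonormal_cols_def)
qed

text \<open>
Compared with a matrix that has orthonormal columns, this notion depends only on the set of
entries and on their distinctness. Sorting or regrouping a basis is therefore immediate.
\<close>
definition orthonormal_list :: "nat \<Rightarrow> real vec list \<Rightarrow> bool" where
  "orthonormal_list n vs \<longleftrightarrow> set vs \<subseteq> carrier_vec n \<and> distinct vs \<and>
     (\<forall>u\<in>set vs. \<forall>v\<in>set vs. u \<bullet> v = (if u = v then 1 else 0))"

lemma orthonormal_list_iff_cols:
  "orthonormal_list n vs \<longleftrightarrow>
     set vs \<subseteq> carrier_vec n \<and> orthonormal_cols n (length vs) (mat_of_cols n vs)"
proof (cases "set vs \<subseteq> carrier_vec n")
  case True
  then have col: "col (mat_of_cols n vs) i = vs ! i" if "i < length vs" for i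
    using that by (simp add: subset_iff)
  have "distinct vs \<and> (\<forall>u\<in>set vs. \<forall>v\<in>set vs. u \<bullet> v = (if u = v then 1 else 0)) \<longleftrightarrow>
        (\<forall>i<length vs. \<forall>j<length vs. vs ! i \<bullet> vs ! j = (if i = j then 1 else 0))" (is "?L \<longleftrightarrow> ?R")
  proof
    assume ?L
    then show ?R by (auto simp: nth_eq_iff_index_eq)
  next
    assume R: ?R
    then have "vs ! i \<noteq> vs ! j" if "i < length vs" "j < length vs" "i \<noteq> j" for i j
      using that by (metis zero_neq_one)
    then have "distinct vs" by (auto simp: distinct_conv_nth)
    then show ?L using R by (auto simp: in_set_conv_nth nth_eq_iff_index_eq)
  qed
  then show ?thesis
    using True by (auto simp: orthonormal_list_def orthonormal_cols_iff_col[of _ n "length vs"] col)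
qed (auto simp: orthonormal_list_def)

text \<open>
Stacking fewer than \<^term>\<open>n\<close> vectors as rows and padding with zero rows gives a singular square
matrix. A vector in its kernel is orthogonal to all of them.
\<close>
lemma exists_unit_orthogonal:
  fixes vs :: "real vec list"
  assumes "set vs \<subseteq> carrier_vec n" "length vs < n"
  obtains u where "u \<in> carrier_vec n" "u \<bullet> u = 1" "\<And>v. v \<in> set vs \<Longrightarrow> v \<bullet> u = 0"
proof -
  define A where "A = mat\<^sub>r n n (\<lambda>i. if i = length vs then 0\<^sub>v n else
     (\<lambda>i. if i < length vs then vs ! i else 0\<^sub>v n) i)"
  have A: "A \<in> carrier_mat n n" by (simp add: A_def)
  have "det A = 0"
    unfolding A_def using assms by (intro det_row_0) (auto simp: subset_iff)
  then obtain w where w: "w \<in> carrier_vec n" "w \<noteq> 0\<^sub>v n" "A *\<^sub>v w = 0\<^sub>v n"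
    using det_0_iff_vec_prod_zero[OF A] by auto
  obtain c where c: "(c \<cdot>\<^sub>v w) \<bullet> (c \<cdot>\<^sub>v w) = 1"
    using exists_unit_multiple[OF w(1,2)] .
  have "v \<bullet> (c \<cdot>\<^sub>v w) = 0" if v: "v \<in> set vs" for v
  proof -
    obtain i where i: "i < length vs" "v = vs ! i" using v by (metis in_set_conv_nth)
    have vi: "vs ! i \<in> carrier_vec n" using i assms(1) by auto
    then have "row A i = v" using i assms by (auto simp: A_def intro!: eq_vecI)
    then have "v \<bullet> w = (A *\<^sub>v w) $ i" using i assms(2) A by simp
    then show ?thesis using w v i vi assms(2) by auto
  qed
  then show thesis using that[of "c \<cdot>\<^sub>v w"] w(1) c by simp
qed

lemma orthonormal_list_snoc:
  assumes "orthonormal_list n vs" "u \<in> carrier_vec n" "u \<bullet> u = 1"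
    "\<And>v. v \<in> set vs \<Longrightarrow> v \<bullet> u = 0"
  shows "orthonormal_list n (vs @ [u])"
proof -
  have "u \<notin> set vs" using assms(3,4) by force
  moreover have "u \<bullet> v = 0" if "v \<in> set vs" for v
    using assms that comm_scalar_prod[of u n v] by (auto simp: orthonormal_list_def)
  ultimately show ?thesis using assms by (auto simp: orthonormal_list_def)
qed

lemma square_orthonormal_cols:
  assumes "orthonormal_cols n n U"
  shows "U * transpose_mat U = 1\<^sub>m n" "orthonormal_cols n n (transpose_mat U)"
  using assms mat_mult_left_right_inverse[of "transpose_mat U" n U]
  by (auto simp: orthonormal_cols_def)

text \<open>
With \<^term>\<open>n\<close> orthonormal columns a square matrix is inverted by its transpose on both sides, so a
vector is recovered from its inner products with the columns.
\<close>
lemma orthonormal_list_complete: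
  assumes "orthonormal_list n vs" "length vs = n" "x \<in> carrier_vec n"
    "\<And>v. v \<in> set vs \<Longrightarrow> v \<bullet> x = 0"
  shows "x = 0\<^sub>v n"
proof -
  define U where "U = mat_of_cols n vs"
  have U: "U \<in> carrier_mat n n" "U * transpose_mat U = 1\<^sub>m n"
    using assms(1,2) square_orthonormal_cols(1) by (auto simp: U_def orthonormal_list_iff_cols)
  have "col U i = vs ! i" if "i < n" for i
    using that assms(1,2) by (auto simp: U_def orthonormal_list_def intro!: col_mat_of_cols)
  then have "transpose_mat U *\<^sub>v x = 0\<^sub>v n"
    using U(1) assms by (intro eq_vecI) auto
  moreover have "x = U *\<^sub>v (transpose_mat U *\<^sub>v x)"
    using U assms(3) by (metis assoc_mult_mat_vec one_mult_mat_vec transpose_carrier_mat)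
  ultimately show ?thesis using U(1) by (auto intro!: eq_vecI)
qed

text \<open>
A vector beyond the first \<^term>\<open>n\<close> would be orthogonal to a complete family and hence vanish.
\<close>
lemma orthonormal_list_length_le:
  assumes "orthonormal_list n vs"
  shows "length vs \<le> n"
proof (rule ccontr)
  assume "\<not> length vs \<le> n"
  then obtain ws u zs where vs: "vs = ws @ u # zs" "length ws = n"
    by (metis append_take_drop_id id_take_nth_drop length_take min.absorb2 nat_le_linear not_le)
  have "orthonormal_list n ws" using assms vs by (auto simp: orthonormal_list_def)
  moreover have "u \<in> carrier_vec n" "v \<bullet> u = 0" if "v \<in> set ws" for v
    using assms vs that by (auto simp: orthonormal_list_def)
  moreover have "u \<in> carrier_vec n" "u \<bullet> u = 1" using assms vs by (auto simp: orthonormal_list_def)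
  ultimately have "u = 0\<^sub>v n" using orthonormal_list_complete vs(2) by blast
  then show False using \<open>u \<bullet> u = 1\<close> by simp
qed

lemma orthonormal_list_extend:
  assumes "orthonormal_list n vs"
  obtains ws where "orthonormal_list n (vs @ ws)" "length (vs @ ws) = n"
proof -
  have "\<exists>ws. orthonormal_list n (vs @ ws) \<and> length (vs @ ws) = length vs + d" if "length vs + d \<le> n" for d
    using that
  proof (induction d)
    case 0
    then show ?case using assms by (intro exI[of _ "[]"]) simp
  next
    case (Suc d)
    then obtain ws where ws: "orthonormal_list n (vs @ ws)" "length (vs @ ws) = length vs + d" by auto
    obtain u where "u \<in> carrier_vec n" "u \<bullet> u = 1" "\<And>v. v \<in> set (vs @ ws) \<Longrightarrow> v \<bullet> u = 0"
      using exists_unit_orthogonal[of "vs @ ws" n] ws Suc.prems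
      by (metis add_Suc_right less_eq_Suc_le orthonormal_list_def)
    from orthonormal_list_snoc[OF ws(1) this] show ?case
      using ws(2) by (intro exI[of _ "ws @ [u]"]) simp
  qed
  from this[of "n - length vs"] show thesis
    using orthonormal_list_length_le[OF assms] that by auto
qed

section \<open>The real spectral theorem\<close>

text \<open>
Over the complex numbers an eigenvector \<open>x + i y\<close> exists. Comparing the two ways to write the
inner product of \<^term>\<open>x\<close> with the image of \<^term>\<open>y\<close> shows that the imaginary part of the eigenvalue
times the squared length of the eigenvector is zero. So the eigenvalue is real, and \<^term>\<open>x\<close> or
\<^term>\<open>y\<close> is a real eigenvector.
\<close>
lemma real_symmetric_eigenvector:
  fixes A :: "real mat"
  assumes A: "A \<in> carrier_mat n n" and sym: "transpose_mat A = A" and "0 < n"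
  obtains v \<mu> where "v \<in> carrier_vec n" "v \<bullet> v = 1" "A *\<^sub>v v = \<mu> \<cdot>\<^sub>v v"
proof -
  define B where "B = map_mat complex_of_real A"
  have B: "B \<in> carrier_mat n n" using A by (simp add: B_def)
  have "degree (char_poly B) = n" using degree_monic_char_poly[OF B] by simp
  then have "\<not> constant (poly (char_poly B))" using \<open>0 < n\<close> by (simp add: constant_degree)
  then obtain e where "poly (char_poly B) e = 0" using fundamental_theorem_of_algebra by blast
  then obtain z where z: "z \<in> carrier_vec n" "z \<noteq> 0\<^sub>v n" "B *\<^sub>v z = e \<cdot>\<^sub>v z"
    using eigenvalue_root_char_poly[OF B] B by (auto simp: eigenvalue_def eigenvector_def)
  define x y where "x = map_vec Re z" and "y = map_vec Im z"
  have xy: "x \<in> carrier_vec n" "y \<in> carrier_vec n" using z(1) by (auto simp: x_def y_def)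
  have Bz: "(B *\<^sub>v z) $ i = (\<Sum>j = 0..<n. complex_of_real (A $$ (i,j)) * z $ j)" if "i < n" for i
    using that A z(1) by (simp add: B_def scalar_prod_def)
  have Ax: "A *\<^sub>v x = Re e \<cdot>\<^sub>v x - Im e \<cdot>\<^sub>v y"
  proof (rule eq_vecI)
    fix i assume "i < dim_vec (Re e \<cdot>\<^sub>v x - Im e \<cdot>\<^sub>v y)"
    then have i: "i < n" using xy by simp
    have "(A *\<^sub>v x) $ i = Re ((B *\<^sub>v z) $ i)"
      unfolding Bz[OF i] using i A z(1) by (simp add: x_def scalar_prod_def)
    then show "(A *\<^sub>v x) $ i = (Re e \<cdot>\<^sub>v x - Im e \<cdot>\<^sub>v y) $ i"
      using i z(1) unfolding z(3) by (simp add: x_def y_def)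
  qed (use A xy in auto)
  have Ay: "A *\<^sub>v y = Im e \<cdot>\<^sub>v x + Re e \<cdot>\<^sub>v y"
  proof (rule eq_vecI)
    fix i assume "i < dim_vec (Im e \<cdot>\<^sub>v x + Re e \<cdot>\<^sub>v y)"
    then have i: "i < n" using xy by simp
    have "(A *\<^sub>v y) $ i = Im ((B *\<^sub>v z) $ i)"
      unfolding Bz[OF i] using i A z(1) by (simp add: y_def scalar_prod_def)
    then show "(A *\<^sub>v y) $ i = (Im e \<cdot>\<^sub>v x + Re e \<cdot>\<^sub>v y) $ i"
      using i z(1) unfolding z(3) by (simp add: x_def y_def)
  qed (use A xy in auto)
  have ne: "x \<noteq> 0\<^sub>v n \<or> y \<noteq> 0\<^sub>v n"
  proof (rule ccontr)
    assume c: "\<not> ?thesis"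
    have "z $ i = 0" if "i < n" for i
    proof -
      have "x $ i = 0" "y $ i = 0" using c that by auto
      then show ?thesis using that z(1) by (simp add: x_def y_def complex_eq_iff)
    qed
    then show False using z(1,2) by auto
  qed
  have "x \<bullet> (A *\<^sub>v y) = (A *\<^sub>v x) \<bullet> y"
    using symmetric_mat_scalar_prod[OF A sym xy] .
  then have "Im e * (x \<bullet> x + y \<bullet> y) = 0"
    unfolding Ax Ay using xy
    by (simp add: scalar_prod_add_distrib[of _ n] minus_scalar_prod_distrib[of _ n] algebra_simps)
  moreover have "x \<bullet> x + y \<bullet> y \<noteq> 0"
    using ne real_scalar_prod_self_eq_0[OF xy(1)] real_scalar_prod_self_eq_0[OF xy(2)]
      real_scalar_prod_ge_0[of x] real_scalar_prod_ge_0[of y]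
    by (auto simp: add_nonneg_eq_0_iff)
  ultimately have "Im e = 0" by simp
  then have eig: "A *\<^sub>v x = Re e \<cdot>\<^sub>v x" "A *\<^sub>v y = Re e \<cdot>\<^sub>v y"
    using Ax Ay xy by (auto intro!: eq_vecI)
  then obtain w where w: "w \<in> carrier_vec n" "w \<noteq> 0\<^sub>v n" "A *\<^sub>v w = Re e \<cdot>\<^sub>v w"
    using ne xy by blast
  obtain c where c: "(c \<cdot>\<^sub>v w) \<bullet> (c \<cdot>\<^sub>v w) = 1"
    using exists_unit_multiple[OF w(1,2)] .
  have "A *\<^sub>v (c \<cdot>\<^sub>v w) = Re e \<cdot>\<^sub>v (c \<cdot>\<^sub>v w)"
    using mult_mat_vec[OF A w(1)] w by (simp add: smult_smult_assoc mult.commute)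
  then show thesis using that[of "c \<cdot>\<^sub>v w"] c w(1) by simp
qed

text \<open>
The orthogonal complement of some eigenvectors of a symmetric matrix is invariant. The compression
of the matrix to this complement is again symmetric, so it has an eigenvector, which extends the
family by one.
\<close>
lemma symmetric_mat_orthonormal_eigenlist:
  fixes A :: "real mat"
  assumes A: "A \<in> carrier_mat n n" and sym: "transpose_mat A = A"
  obtains vs where "orthonormal_list n vs" "length vs = n"
    "\<And>v. v \<in> set vs \<Longrightarrow> \<exists>\<mu>. A *\<^sub>v v = \<mu> \<cdot>\<^sub>v v"
proof -
  have "\<exists>vs. orthonormal_list n vs \<and> length vs = c \<and> (\<forall>v\<in>set vs. \<exists>\<mu>. A *\<^sub>v v = \<mu> \<cdot>\<^sub>v v)"
    if "c \<le> n" for c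
    using that
  proof (induction c)
    case 0
    then show ?case by (intro exI[of _ "[]"]) (simp add: orthonormal_list_def)
  next
    case (Suc c)
    then obtain vs where vs: "orthonormal_list n vs" "length vs = c"
      "\<And>v. v \<in> set vs \<Longrightarrow> \<exists>\<mu>. A *\<^sub>v v = \<mu> \<cdot>\<^sub>v v" by auto
    obtain ws where ws: "orthonormal_list n (vs @ ws)" "length (vs @ ws) = n"
      using orthonormal_list_extend[OF vs(1)] .
    have car: "v \<in> carrier_vec n" if "v \<in> set (vs @ ws)" for v
      using that ws(1) by (auto simp: orthonormal_list_def)
    define d where "d = length ws"
    \<comment> \<open>\<^term>\<open>Z\<close> carries an eigenvector of the compression back to one of \<^term>\<open>A\<close>.\<close>
  define Z where "Z = mat_of_cols n ws"
    have d: "0 < d" using ws(2) vs(2) Suc.prems by (simp add: d_def del: length_greater_0_conv)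
    have Z: "Z \<in> carrier_mat n d" by (simp add: Z_def d_def)
    have "orthonormal_list n ws" using ws(1) by (auto simp: orthonormal_list_def)
    then have ZZ: "transpose_mat Z * Z = 1\<^sub>m d"
      by (simp add: orthonormal_list_iff_cols orthonormal_cols_def Z_def d_def)
    have colZ: "col Z i = ws ! i" if "i < d" for i
      using that car by (simp add: Z_def d_def)
    define B where "B = transpose_mat Z * (A * Z)"
    have B: "B \<in> carrier_mat d d" using Z A by (simp add: B_def)
    have "transpose_mat B = transpose_mat (A * Z) * Z"
      using Z A by (simp add: B_def transpose_mult[of _ d n _ d])
    also have "\<dots> = B"
      using Z A sym by (simp add: B_def transpose_mult[of _ n n _ d])
    finally have symB: "transpose_mat B = B" .
    obtain x \<mu> where x: "x \<in> carrier_vec d" "x \<bullet> x = 1" "B *\<^sub>v x = \<mu> \<cdot>\<^sub>v x"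
      using real_symmetric_eigenvector[OF B symB d] .
    define z where "z = Z *\<^sub>v x"
    have z: "z \<in> carrier_vec n" using Z x by (simp add: z_def)
    have Az: "A *\<^sub>v z \<in> carrier_vec n" using A z by simp
    have Ztz: "transpose_mat Z *\<^sub>v z = x"
      unfolding z_def using Z x ZZ
      by (metis assoc_mult_mat_vec one_mult_mat_vec transpose_carrier_mat)
    have "z \<bullet> z = (transpose_mat Z *\<^sub>v z) \<bullet> x"
      using transpose_vec_mult_scalar[OF Z x(1) z] by (simp add: z_def)
    then have zz: "z \<bullet> z = 1" using Ztz x by simp
    have vz: "v \<bullet> z = 0" if v: "v \<in> set vs" for v
    proof -
      have "transpose_mat Z *\<^sub>v v = 0\<^sub>v d"
      proof (rule eq_vecI)
        fix i assume "i < dim_vec (0\<^sub>v d :: real vec)"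
        then have i: "i < d" by simp
        then have "ws ! i \<in> set ws" by (simp add: d_def)
        moreover have "ws ! i \<noteq> v"
          using ws(1) v \<open>ws ! i \<in> set ws\<close> by (auto simp: orthonormal_list_def)
        ultimately have "ws ! i \<bullet> v = 0" using ws(1) v by (auto simp: orthonormal_list_def)
        then show "(transpose_mat Z *\<^sub>v v) $ i = 0\<^sub>v d $ i" using i Z colZ by simp
      qed (use Z in simp)
      then show ?thesis
        using transpose_vec_mult_scalar[OF Z x(1) car[of v]] v x by (simp add: z_def)
    qed
    have "A *\<^sub>v z - \<mu> \<cdot>\<^sub>v z = 0\<^sub>v n"
    proof (rule orthonormal_list_complete[OF ws])
      fix v assume v: "v \<in> set (vs @ ws)"
      have *: "v \<bullet> (A *\<^sub>v z - \<mu> \<cdot>\<^sub>v z) = v \<bullet> (A *\<^sub>v z) - \<mu> * (v \<bullet> z)"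
        using car[OF v] z Az by (simp add: scalar_prod_minus_distrib[of _ n])
      show "v \<bullet> (A *\<^sub>v z - \<mu> \<cdot>\<^sub>v z) = 0"
      proof (cases "v \<in> set vs")
        case True
        then obtain \<nu> where "A *\<^sub>v v = \<nu> \<cdot>\<^sub>v v" using vs(3) by auto
        then have "v \<bullet> (A *\<^sub>v z) = 0"
          using symmetric_mat_scalar_prod[OF A sym car[OF v] z] vz[OF True] car[OF v] z by simp
        then show ?thesis using * vz[OF True] by simp
      next
        case False
        then obtain i where i: "i < d" "v = ws ! i"
          using v by (auto simp: in_set_conv_nth d_def)
        have "transpose_mat Z *\<^sub>v (A *\<^sub>v z) = B *\<^sub>v x"
          using assoc_mult_mat_vec[of "transpose_mat Z" d n "A * Z" d x] Z A x(1) by (simp add: B_def z_def)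
        then have "transpose_mat Z *\<^sub>v (A *\<^sub>v z) = \<mu> \<cdot>\<^sub>v (transpose_mat Z *\<^sub>v z)"
          using x Ztz by simp
        then have "(transpose_mat Z *\<^sub>v (A *\<^sub>v z)) $ i = (\<mu> \<cdot>\<^sub>v (transpose_mat Z *\<^sub>v z)) $ i" by simp
        then have "v \<bullet> (A *\<^sub>v z) = \<mu> * (v \<bullet> z)" using i Z colZ by simp
        then show ?thesis using * by simp
      qed
    qed (use z Az in simp)
    then have "(A *\<^sub>v z - \<mu> \<cdot>\<^sub>v z) $ i = 0" if "i < n" for i using that by simp
    then have "A *\<^sub>v z = \<mu> \<cdot>\<^sub>v z"
      using z Az A by (intro eq_vecI) auto
    then show ?case
      using orthonormal_list_snoc[OF vs(1) z zz vz] vs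
      by (intro exI[of _ "vs @ [z]"]) auto
  qed
  from this[of n] show thesis using that by blast
qed

text \<open>
The eigenvalues come in descending order so that they can be compared with the singular values by
position.
\<close>
lemma real_spectral_theorem:
  fixes A :: "real mat"
  assumes A: "A \<in> carrier_mat n n" and sym: "transpose_mat A = A"
  obtains W d where "orthonormal_cols n n W"
    "\<And>i. i < n \<Longrightarrow> A *\<^sub>v col W i = d i \<cdot>\<^sub>v col W i"
    "\<And>i j. i \<le> j \<Longrightarrow> j < n \<Longrightarrow> d j \<le> (d i :: real)"
proof -
  obtain us where us: "orthonormal_list n us" "length us = n"
    "\<And>v. v \<in> set us \<Longrightarrow> \<exists>\<mu>. A *\<^sub>v v = \<mu> \<cdot>\<^sub>v v"
    using symmetric_mat_orthonormal_eigenlist[OF A sym] by blast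
  \<comment> \<open>The Rayleigh quotient recovers the eigenvalue of a unit eigenvector.\<close>
  define r where "r = (\<lambda>v. v \<bullet> (A *\<^sub>v v))"
  define vs where "vs = sort_key (\<lambda>v. - r v) us"
  have set: "set vs = set us" and len: "length vs = n" by (simp_all add: vs_def us)
  have vs: "orthonormal_list n vs"
    using us(1) set by (simp add: orthonormal_list_def vs_def)
  have car: "vs ! i \<in> carrier_vec n" if "i < n" for i
    using vs that len nth_mem by (fastforce simp: orthonormal_list_def)
  have col: "col (mat_of_cols n vs) i = vs ! i" if "i < n" for i
    using that len car by simp
  have eig: "A *\<^sub>v vs ! i = r (vs ! i) \<cdot>\<^sub>v vs ! i" if i: "i < n" for i
  proof -
    have "vs ! i \<in> set us" using i len set nth_mem by blast
    then obtain \<mu> where \<mu>: "A *\<^sub>v vs ! i = \<mu> \<cdot>\<^sub>v vs ! i" using us(3) by blast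
    have "vs ! i \<bullet> vs ! i = 1" using i len nth_mem[of i vs] vs by (simp add: orthonormal_list_def)
    then have "r (vs ! i) = \<mu>" using car[OF i] unfolding r_def \<mu> by simp
    then show ?thesis using \<mu> by simp
  qed
  have "sorted (map (\<lambda>v. - r v) vs)" by (simp add: vs_def)
  then have "r (vs ! j) \<le> r (vs ! i)" if "i \<le> j" "j < n" for i j
    using that len by (simp add: sorted_iff_nth_mono)
  then show thesis
    using that[of "mat_of_cols n vs" "\<lambda>i. r (vs ! i)"] vs eig col len
    by (simp add: orthonormal_list_iff_cols)
qed

text \<open>
An orthonormal eigenbasis makes the matrix similar to a diagonal one, so the characteristic
polynomial splits over the reals. This gives access to the roots by which singular values are
defined.
\<close>
lemma proots_char_poly_eigenbasis:
  fixes A :: "real mat"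
  assumes A: "A \<in> carrier_mat n n" and W: "orthonormal_cols n n W"
    and eig: "\<And>i. i < n \<Longrightarrow> A *\<^sub>v col W i = d i \<cdot>\<^sub>v col W i"
  shows "proots (char_poly A) = mset (map d [0..<n])"
proof -
  define D where "D = mat n n (\<lambda>(i,j). if i = j then d i else 0)"
  have D: "D \<in> carrier_mat n n" by (simp add: D_def)
  have Wc: "W \<in> carrier_mat n n" "transpose_mat W * W = 1\<^sub>m n" "W * transpose_mat W = 1\<^sub>m n"
    using W square_orthonormal_cols(1)[OF W] by (auto simp: orthonormal_cols_def)
  have "A * W = W * D"
  proof (rule eq_matI)
    fix i j assume "i < dim_row (W * D)" "j < dim_col (W * D)"
    then have ij: "i < n" "j < n" using Wc D by auto
    have "(A * W) $$ (i,j) = (A *\<^sub>v col W j) $ i" using ij A Wc by simp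
    also have "\<dots> = d j * W $$ (i,j)" using eig[OF ij(2)] ij Wc by simp
    also have "\<dots> = (\<Sum>k = 0..<n. if k = j then d j * W $$ (i,j) else 0)" using ij by simp
    also have "\<dots> = (\<Sum>k = 0..<n. W $$ (i,k) * D $$ (k,j))"
      using ij by (intro sum.cong) (auto simp: D_def)
    also have "\<dots> = (W * D) $$ (i,j)" using ij Wc D by (simp add: scalar_prod_def)
    finally show "(A * W) $$ (i,j) = (W * D) $$ (i,j)" .
  qed (use A Wc D in auto)
  then have "A = W * D * transpose_mat W"
    using Wc A by (metis assoc_mult_mat right_mult_one_mat transpose_carrier_mat)
  then have "similar_mat_wit A D W (transpose_mat W)"
    using A D Wc by (intro similar_mat_witI[of _ _ n]) auto
  then have "char_poly A = char_poly D"
    by (intro char_poly_similar) (auto simp: similar_mat_def)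
  also have "\<dots> = (\<Prod>a\<leftarrow>diag_mat D. [:- a, 1:])"
    using D by (intro char_poly_upper_triangular) (auto simp: upper_triangular_def D_def)
  also have "diag_mat D = map d [0..<n]" by (auto simp: diag_mat_def D_def)
  finally have "char_poly A = (\<Prod>i\<leftarrow>[0..<n]. [:- d i, 1:])" by (simp add: o_def)
  moreover have "proots (\<Prod>i\<leftarrow>ns. [:- d i, 1:]) = mset (map d ns)" for ns :: "nat list"
  proof (induction ns)
    case (Cons i ns)
    have "(\<Prod>i\<leftarrow>ns. [:- d i, 1:]) \<noteq> 0" by (auto simp: prod_list_zero_iff)
    then show ?case using Cons by (simp add: proots_mult del: mult_pCons_left)
  qed simp
  ultimately show ?thesis by metis
qed

section \<open>Singular values and the singular value decomposition\<close>

text \<open>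
The spectral theorem for the Gram matrix of \<^term>\<open>Y\<close>. It has a full set of real eigenvalues, so
the sorted list of roots in the definition of singular values has full length and consists of
them. They are nonnegative, being the squared lengths of the images of unit eigenvectors, so
squaring a singular value gives back the eigenvalue.
\<close>
lemma right_singular_vectors:
  fixes Y :: "real mat"
  assumes Y: "Y \<in> carrier_mat m N"
  obtains W where "orthonormal_cols N N W"
    "\<And>i. i < N \<Longrightarrow> transpose_mat Y *\<^sub>v (Y *\<^sub>v col W i) = (singular_value Y (i + 1))\<^sup>2 \<cdot>\<^sub>v col W i"
    "\<And>i j. i \<le> j \<Longrightarrow> singular_value Y (j + 1) \<le> singular_value Y (i + 1)"
    "\<And>i. 0 \<le> singular_value Y (i + 1)"
proof -
  define A where "A = transpose_mat Y * Y"
  have A: "A \<in> carrier_mat N N" using Y by (simp add: A_def)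
  have "transpose_mat A = A" using Y by (simp add: A_def transpose_mult[of _ N m _ N])
  from real_spectral_theorem[OF A this] obtain W d where W: "orthonormal_cols N N W"
    and eig: "\<And>i. i < N \<Longrightarrow> A *\<^sub>v col W i = d i \<cdot>\<^sub>v col W i"
    and mono: "\<And>i j. i \<le> j \<Longrightarrow> j < N \<Longrightarrow> d j \<le> (d i :: real)" by metis
  have Wc: "W \<in> carrier_mat N N" using W by (simp add: orthonormal_cols_def)
  have d0: "0 \<le> d i" if i: "i < N" for i
  proof -
    have w: "col W i \<in> carrier_vec N" "col W i \<bullet> col W i = 1"
      using i Wc W by (simp_all add: orthonormal_cols_iff_col)
    have "d i = (A *\<^sub>v col W i) \<bullet> col W i" using eig[OF i] w by simp
    also have "A *\<^sub>v col W i = transpose_mat Y *\<^sub>v (Y *\<^sub>v col W i)"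
      using Y w by (simp add: A_def)
    also have "\<dots> \<bullet> col W i = (Y *\<^sub>v col W i) \<bullet> (Y *\<^sub>v col W i)"
      using Y w(1) by (intro transpose_vec_mult_scalar[OF Y]) simp_all
    finally show ?thesis using real_scalar_prod_ge_0 by metis
  qed
  define xs where "xs = map d [0..<N]"
  have "sorted (rev xs)"
    using mono by (auto simp: sorted_iff_nth_mono rev_nth xs_def)
  then have "sort (rev xs) = rev xs" by (rule sorted_sort_id)
  moreover have "proots (char_poly A) = mset (rev xs)"
    using proots_char_poly_eigenbasis[OF A W eig] by (simp add: xs_def)
  ultimately have "rev (sorted_list_of_multiset (proots (char_poly A))) = xs"
    by (simp add: sorted_list_of_multiset_mset del: mset_rev)
  then have sv: "singular_value Y (i + 1) = (if i < N then sqrt (d i) else 0)" for i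
    using Y by (auto simp: singular_value_def A_def xs_def)
  show thesis
  proof (rule that[OF W])
    fix i assume i: "i < N"
    have "col W i \<in> carrier_vec N" using Wc col_dim[of W i] by simp
    then have "transpose_mat Y *\<^sub>v (Y *\<^sub>v col W i) = A *\<^sub>v col W i"
      using Y by (simp add: A_def)
    then show "transpose_mat Y *\<^sub>v (Y *\<^sub>v col W i) = (singular_value Y (i + 1))\<^sup>2 \<cdot>\<^sub>v col W i"
      unfolding sv using eig[OF i] i d0[OF i] by simp
  qed (use mono d0 in \<open>auto simp: sv[simplified]\<close>)
qed

lemma singular_value_antimono:
  assumes "1 \<le> i" "i \<le> j"
  shows "singular_value Y j \<le> singular_value Y i"
proof -
  obtain W where "\<And>i j. i \<le> j \<Longrightarrow> singular_value Y (j + 1) \<le> singular_value Y (i + 1)"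
    using right_singular_vectors[of Y "dim_row Y" "dim_col Y"] by blast
  from this[of "i - 1" "j - 1"] show ?thesis using assms by simp
qed

lemma singular_value_nonneg: "0 \<le> singular_value Y i"
proof (cases i)
  case (Suc j)
  obtain W where "\<And>i. 0 \<le> singular_value Y (i + 1)"
    using right_singular_vectors[of Y "dim_row Y" "dim_col Y"] by blast
  from this[of j] show ?thesis using Suc by simp
qed (simp add: singular_value_def)

text \<open>
\<^term>\<open>S\<close> may be rectangular. Columns of the product beyond the size of \<^term>\<open>U\<close> are zero.
\<close>
lemma mult_diagonal_mat_index:
  fixes U S :: "real mat"
  assumes "U \<in> carrier_mat r m" "S \<in> carrier_mat m N" "diagonal_mat S" "i < r" "j < N"
  shows "(U * S) $$ (i, j) = (if j < m then U $$ (i, j) * S $$ (j, j) else 0)"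
proof -
  have "(U * S) $$ (i, j) = (\<Sum>k = 0..<m. U $$ (i, k) * S $$ (k, j))"
    using assms by (simp add: scalar_prod_def)
  also have "\<dots> = (\<Sum>k = 0..<m. if k = j then U $$ (i, j) * S $$ (j, j) else 0)"
    using assms by (intro sum.cong) (auto simp: diagonal_mat_def)
  finally show ?thesis by auto
qed

text \<open>
The images of the right singular vectors are pairwise orthogonal, and their lengths are the
singular values. The nonzero ones, normalised and extended to a full basis, form \<open>U\<close>.
\<close>
lemma svd_exists: "\<exists>U S W. is_svd Y U S W"
proof -
  define m N where "m = dim_row Y" and "N = dim_col Y"
  have Y: "Y \<in> carrier_mat m N" by (auto simp: m_def N_def)
  define \<sigma> where "\<sigma> i = singular_value Y (i + 1)" for i
  obtain W where W: "orthonormal_cols N N W"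
    and eig: "\<And>i. i < N \<Longrightarrow> transpose_mat Y *\<^sub>v (Y *\<^sub>v col W i) = (\<sigma> i)\<^sup>2 \<cdot>\<^sub>v col W i"
    using right_singular_vectors[OF Y] unfolding \<sigma>_def by metis
  have Wc: "W \<in> carrier_mat N N" using W by (simp add: orthonormal_cols_def)
  have Wcol: "col W i \<in> carrier_vec N" for i using Wc col_dim[of W i] by simp
  then have YWc: "Y *\<^sub>v col W i \<in> carrier_vec m" for i using Y by simp
  have YW: "(Y *\<^sub>v col W i) \<bullet> (Y *\<^sub>v col W j) = (if i = j then (\<sigma> j)\<^sup>2 else 0)" if ij: "i < N" "j < N" for i j
  proof -
    have "(Y *\<^sub>v col W i) \<bullet> (Y *\<^sub>v col W j) = (transpose_mat Y *\<^sub>v (Y *\<^sub>v col W j)) \<bullet> col W i"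
      using transpose_vec_mult_scalar[OF Y Wcol YWc, of j i] comm_scalar_prod[OF YWc YWc, of i j] by simp
    also have "\<dots> = (\<sigma> j)\<^sup>2 * (col W j \<bullet> col W i)" using eig[OF ij(2)] Wc by simp
    also have "\<dots> = (if i = j then (\<sigma> j)\<^sup>2 else 0)" using W Wc ij by (auto simp: orthonormal_cols_iff_col)
    finally show ?thesis .
  qed
  \<comment> \<open>The rank: the singular values descend, so exactly the first \<open>\<rho>\<close> are positive.\<close>
  define \<rho> where "\<rho> = (LEAST i. N \<le> i \<or> \<sigma> i = 0)"
  have "N \<le> \<rho> \<or> \<sigma> \<rho> = 0" unfolding \<rho>_def by (rule LeastI[of _ N]) simp
  have \<rho>N: "\<rho> \<le> N" unfolding \<rho>_def by (rule Least_le) simp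
  have pos: "\<sigma> i > 0" if "i < \<rho>" for i
    using not_less_Least[of i "\<lambda>i. N \<le> i \<or> \<sigma> i = 0"] that singular_value_nonneg[of Y "i + 1"]
    by (fold \<rho>_def) (auto simp: \<sigma>_def)
  have zero: "\<sigma> i = 0" if "\<rho> \<le> i" "i < N" for i
    using that \<open>N \<le> \<rho> \<or> \<sigma> \<rho> = 0\<close> singular_value_antimono[of "\<rho> + 1" "i + 1" Y]
      singular_value_nonneg[of Y "i + 1"] by (auto simp: \<sigma>_def)
  define us where "us = map (\<lambda>i. (1 / \<sigma> i) \<cdot>\<^sub>v (Y *\<^sub>v col W i)) [0..<\<rho>]"
  have us_set: "set us \<subseteq> carrier_vec m" using YWc by (auto simp: us_def)
  have us_car: "us ! i \<in> carrier_vec m" if "i < \<rho>" for i using that YWc by (simp add: us_def)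
  have us_len: "length us = \<rho>" by (simp add: us_def)
  have "us ! i \<bullet> us ! j = (if i = j then 1 else 0)" if ij: "i < \<rho>" "j < \<rho>" for i j
  proof -
    have "us ! i \<bullet> us ! j = 1 / \<sigma> i * (1 / \<sigma> j) * ((Y *\<^sub>v col W i) \<bullet> (Y *\<^sub>v col W j))"
      using ij scalar_prod_smult[OF YWc YWc] by (simp add: us_def)
    then show ?thesis using YW[of i j] ij \<rho>N pos[of i] by (auto simp: power2_eq_square)
  qed
  then have "orthonormal_list m us"
    unfolding orthonormal_list_iff_cols using us_set us_car us_len
    by (auto simp: orthonormal_cols_iff_col[OF mat_of_cols_carrier(1)])
  then obtain zs where zs: "orthonormal_list m (us @ zs)" "length (us @ zs) = m"
    using orthonormal_list_extend by blast
  define U where "U = mat_of_cols m (us @ zs)"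
  have U: "orthonormal_cols m m U" using zs by (simp add: U_def orthonormal_list_iff_cols)
  then have Uc: "U \<in> carrier_mat m m" by (simp add: orthonormal_cols_def)
  have \<rho>m: "\<rho> \<le> m" using zs(2) us_len by simp
  have colU: "col U i = us ! i" if "i < \<rho>" for i
  proof -
    have "col U i = (us @ zs) ! i"
      unfolding U_def using that zs us_len us_car by (intro col_mat_of_cols) (auto simp: nth_append)
    then show ?thesis using that us_len by (simp add: nth_append)
  qed
  define S where "S = mat m N (\<lambda>(i,j). if i = j then \<sigma> i else 0)"
  have S: "S \<in> carrier_mat m N" "diagonal_mat S" by (auto simp: S_def diagonal_mat_def)
  have "Y * W = U * S"
  proof (rule eq_matI)
    fix i j assume "i < dim_row (U * S)" "j < dim_col (U * S)"
    then have ij: "i < m" "j < N" using Uc S by auto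
    have L: "(Y * W) $$ (i,j) = (Y *\<^sub>v col W j) $ i" using ij Y Wc by simp
    have R: "(U * S) $$ (i,j) = (if j < m then U $$ (i,j) * \<sigma> j else 0)"
      using mult_diagonal_mat_index[OF Uc S ij] ij by (simp add: S_def)
    show "(Y * W) $$ (i,j) = (U * S) $$ (i,j)"
    proof (cases "j < \<rho>")
      case True
      have "U $$ (i,j) = col U j $ i" using ij True \<rho>m Uc by simp
      also have "\<dots> = 1 / \<sigma> j * (Y *\<^sub>v col W j) $ i"
        unfolding colU[OF True] using True ij Y by (simp add: us_def)
      finally show ?thesis using L R pos[OF True] True \<rho>m by simp
    next
      case False
      then have "\<sigma> j = 0" using zero ij by simp
      moreover have "Y *\<^sub>v col W j = 0\<^sub>v m"
        using YW[of j j] ij \<open>\<sigma> j = 0\<close> real_scalar_prod_self_eq_0[OF YWc] by simp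
      ultimately show ?thesis using L R ij by simp
    qed
  qed (use Y Wc Uc S in auto)
  then have "Y = U * S * transpose_mat W"
    using assoc_mult_mat[OF Y Wc, of "transpose_mat W" N] Wc Y square_orthonormal_cols(1)[OF W]
    by simp
  moreover have "\<forall>i < min m N. S $$ (i, i) = singular_value Y (i + 1)"
    by (simp add: S_def \<sigma>_def)
  ultimately have "is_svd Y U S W"
    unfolding is_svd_def m_def[symmetric] N_def[symmetric] using U W S by blast
  then show ?thesis by blast
qed

section \<open>Frobenius norm and orthogonal projection\<close>

lemma frob_norm_sq:
  "(frob_norm A)\<^sup>2 = (\<Sum>i<dim_row A. \<Sum>j<dim_col A. (A $$ (i, j))\<^sup>2)"
  by (simp add: frob_norm_def sum_nonneg)

lemma frob_norm_sq_cols: "(frob_norm A)\<^sup>2 = (\<Sum>j<dim_col A. col A j \<bullet> col A j)"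
proof -
  have "col A j \<bullet> col A j = (\<Sum>i<dim_row A. (A $$ (i, j))\<^sup>2)" if "j < dim_col A" for j
    using that by (simp add: scalar_prod_def power2_eq_square atLeast0LessThan)
  then show ?thesis
    unfolding frob_norm_sq by (subst sum.swap) simp
qed

lemma frob_norm_transpose: "frob_norm (transpose_mat A) = frob_norm A"
  unfolding frob_norm_def by (subst sum.swap) simp

lemma orthonormal_cols_scalar_prod:
  assumes "orthonormal_cols r c Q" "u \<in> carrier_vec c" "v \<in> carrier_vec c"
  shows "(Q *\<^sub>v u) \<bullet> (Q *\<^sub>v v) = u \<bullet> v"
proof -
  have Q: "Q \<in> carrier_mat r c" "transpose_mat Q * Q = 1\<^sub>m c"
    using assms(1) by (auto simp: orthonormal_cols_def)
  have "(Q *\<^sub>v u) \<bullet> (Q *\<^sub>v v) = (transpose_mat Q *\<^sub>v (Q *\<^sub>v u)) \<bullet> v"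
    using transpose_vec_mult_scalar[OF Q(1) assms(3), of "Q *\<^sub>v u"] Q(1) assms by simp
  also have "transpose_mat Q *\<^sub>v (Q *\<^sub>v u) = (transpose_mat Q * Q) *\<^sub>v u"
    using Q(1) assms(2) by simp
  finally show ?thesis using Q(2) assms(2) by simp
qed

lemma orthonormal_cols_mult:
  assumes Q: "orthonormal_cols r m Q" and V: "orthonormal_cols m c V"
  shows "orthonormal_cols r c (Q * V)"
proof -
  have Qc: "Q \<in> carrier_mat r m" and Vc: "V \<in> carrier_mat m c"
    using Q V by (simp_all add: orthonormal_cols_def)
  then have QV: "Q * V \<in> carrier_mat r c" by simp
  have "col (Q * V) i \<bullet> col (Q * V) j = col V i \<bullet> col V j" if "i < c" "j < c" for i j
    unfolding col_mult2[OF Qc Vc that(1)] col_mult2[OF Qc Vc that(2)]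
    using Vc col_dim[of V i] col_dim[of V j] by (intro orthonormal_cols_scalar_prod[OF Q]) auto
  then show ?thesis
    using V by (simp add: orthonormal_cols_iff_col[OF QV] orthonormal_cols_iff_col[OF Vc])
qed

lemma frob_norm_orthonormal_mult:
  assumes Q: "orthonormal_cols r c Q" and A: "A \<in> carrier_mat c N"
  shows "frob_norm (Q * A) = frob_norm A"
proof -
  have Qc: "Q \<in> carrier_mat r c" using Q by (simp add: orthonormal_cols_def)
  have "col (Q * A) j \<bullet> col (Q * A) j = col A j \<bullet> col A j" if "j < N" for j
    using that Qc A orthonormal_cols_scalar_prod[OF Q, of "col A j" "col A j"] by simp
  then have "(frob_norm (Q * A))\<^sup>2 = (frob_norm A)\<^sup>2"
    using A by (simp add: frob_norm_sq_cols)
  then show ?thesis by (simp add: frob_norm_def sum_nonneg)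
qed

lemma frob_norm_mult_transpose_orthonormal:
  assumes W: "orthonormal_cols N N W" and A: "A \<in> carrier_mat r N"
  shows "frob_norm (A * transpose_mat W) = frob_norm A"
proof -
  have Wc: "W \<in> carrier_mat N N" using W by (simp add: orthonormal_cols_def)
  have "frob_norm (A * transpose_mat W) = frob_norm (W * transpose_mat A)"
    using transpose_mult[of A r N "transpose_mat W" N] Wc A
      frob_norm_transpose[of "A * transpose_mat W"] by simp
  also have "\<dots> = frob_norm A"
    using frob_norm_orthonormal_mult[OF W, of "transpose_mat A" r] A by (simp add: frob_norm_transpose)
  finally show ?thesis .
qed

lemma frob_norm_sq_orthonormal_cols:
  assumes "orthonormal_cols r c V"
  shows "(frob_norm V)\<^sup>2 = real c"
proof -
  have V: "V \<in> carrier_mat r c" using assms by (simp add: orthonormal_cols_def)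
  have "col V j \<bullet> col V j = 1" if "j < c" for j
    using assms that by (simp add: orthonormal_cols_iff_col[OF V])
  then show ?thesis using V by (simp add: frob_norm_sq_cols)
qed

lemma projector_mult_vec:
  fixes V :: "real mat"
  assumes "V \<in> carrier_mat m r" "u \<in> carrier_vec m"
  shows "(1\<^sub>m m - V * transpose_mat V) *\<^sub>v u = u - V *\<^sub>v (transpose_mat V *\<^sub>v u)"
  using assms by (subst minus_mult_distrib_mat_vec[of _ m m]) auto

text \<open>
Pythagoras for the orthogonal decomposition of \<^term>\<open>u\<close> along the column space of \<^term>\<open>V\<close>.
\<close>
lemma projection_residual_norm_sq:
  assumes V: "orthonormal_cols m r V" and u: "u \<in> carrier_vec m"
  shows "((1\<^sub>m m - V * transpose_mat V) *\<^sub>v u) \<bullet> ((1\<^sub>m m - V * transpose_mat V) *\<^sub>v u)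
     = u \<bullet> u - (transpose_mat V *\<^sub>v u) \<bullet> (transpose_mat V *\<^sub>v u)"
proof -
  have Vc: "V \<in> carrier_mat m r" using V by (simp add: orthonormal_cols_def)
  define x where "x = transpose_mat V *\<^sub>v u"
  have x: "x \<in> carrier_vec r" "V *\<^sub>v x \<in> carrier_vec m" using Vc u by (auto simp: x_def)
  have "u \<bullet> (V *\<^sub>v x) = x \<bullet> x"
    using transpose_vec_mult_scalar[OF Vc x(1) u] by (simp add: x_def)
  moreover have "(V *\<^sub>v x) \<bullet> u = x \<bullet> x"
    using comm_scalar_prod[OF x(2) u] calculation by simp
  moreover have "(V *\<^sub>v x) \<bullet> (V *\<^sub>v x) = x \<bullet> x"
    using orthonormal_cols_scalar_prod[OF V x(1) x(1)] .
  ultimately have "(u - V *\<^sub>v x) \<bullet> (u - V *\<^sub>v x) = u \<bullet> u - x \<bullet> x"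
    using u x by (simp add: scalar_prod_minus_distrib[of _ m] minus_scalar_prod_distrib[of _ m])
  then show ?thesis unfolding projector_mult_vec[OF Vc u] by (simp add: x_def)
qed

section \<open>Best approximation by a subspace of fixed dimension\<close>

text \<open>
The right factor of the decomposition preserves the Frobenius norm, and the middle factor scales
the residual of each left singular vector by a singular value. The sum can run over all of them:
singular values whose index exceeds the number of columns are zero by convention.
\<close>
lemma projection_error_svd:
  assumes svd: "is_svd Y U S W" and Y: "Y \<in> carrier_mat m N" and V: "orthonormal_cols m r V"
  shows "(frob_norm ((1\<^sub>m m - V * transpose_mat V) * Y))\<^sup>2
    = (\<Sum>j<m. (singular_value Y (j + 1))\<^sup>2 *
        (1 - (transpose_mat V *\<^sub>v col U j) \<bullet> (transpose_mat V *\<^sub>v col U j)))"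
proof -
  have U: "orthonormal_cols m m U" and W: "orthonormal_cols N N W"
    and S: "S \<in> carrier_mat m N" "diagonal_mat S"
    and sv: "\<And>i. i < m \<Longrightarrow> i < N \<Longrightarrow> S $$ (i, i) = singular_value Y (i + 1)"
    and YU: "Y = U * S * transpose_mat W"
    using svd Y by (auto simp: is_svd_def)
  have c: "U \<in> carrier_mat m m" "V \<in> carrier_mat m r" "W \<in> carrier_mat N N"
    using U V W by (auto simp: orthonormal_cols_def)
  define C where "C = 1\<^sub>m m - V * transpose_mat V"
  have C: "C \<in> carrier_mat m m"
    using c by (intro carrier_matI) (simp_all add: C_def)
  have res: "(C *\<^sub>v col U j) \<bullet> (C *\<^sub>v col U j)
      = 1 - (transpose_mat V *\<^sub>v col U j) \<bullet> (transpose_mat V *\<^sub>v col U j)" if "j < m" for j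
    using projection_residual_norm_sq[OF V, of "col U j"] that c U
    by (simp add: C_def orthonormal_cols_iff_col)
  have "C * Y = C * U * S * transpose_mat W"
  proof -
    have US: "U * S \<in> carrier_mat m N" using c S by simp
    have "C * Y = C * (U * S) * transpose_mat W"
      unfolding YU by (rule assoc_mult_mat[symmetric, OF C US]) (use c in simp)
    also have "C * (U * S) = C * U * S"
      by (rule assoc_mult_mat[symmetric, OF C c(1) S(1)])
    finally show ?thesis .
  qed
  then have "(frob_norm (C * Y))\<^sup>2 = (frob_norm (C * U * S))\<^sup>2"
    using frob_norm_mult_transpose_orthonormal[OF W, of "C * U * S" m] C c S by simp
  also have "\<dots> = (\<Sum>j<N. col (C * U * S) j \<bullet> col (C * U * S) j)"
    using S by (simp add: frob_norm_sq_cols)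
  also have "\<dots> = (\<Sum>j<N. if j < m then (singular_value Y (j + 1))\<^sup>2 * ((C *\<^sub>v col U j) \<bullet> (C *\<^sub>v col U j)) else 0)"
  proof (intro sum.cong refl)
    fix j assume "j \<in> {..<N}"
    then have j: "j < N" by simp
    have CU: "C * U \<in> carrier_mat m m" using C c by simp
    have "col (C * U * S) j = (if j < m then singular_value Y (j + 1) \<cdot>\<^sub>v (C *\<^sub>v col U j) else 0\<^sub>v m)"
    proof (rule eq_vecI)
      fix i assume "i < dim_vec (if j < m then singular_value Y (j + 1) \<cdot>\<^sub>v (C *\<^sub>v col U j) else 0\<^sub>v m)"
      then have i: "i < m" using C by (auto split: if_splits)
      have "col (C * U * S) j $ i = (C * U * S) $$ (i, j)" using i j C c S by simp
      then show "col (C * U * S) j $ i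
          = (if j < m then singular_value Y (j + 1) \<cdot>\<^sub>v (C *\<^sub>v col U j) else 0\<^sub>v m) $ i"
        using mult_diagonal_mat_index[OF CU S i j] i j C c sv[of j] by auto
    qed (use C S c in auto)
    then show "col (C * U * S) j \<bullet> col (C * U * S) j
        = (if j < m then (singular_value Y (j + 1))\<^sup>2 * ((C *\<^sub>v col U j) \<bullet> (C *\<^sub>v col U j)) else 0)"
      using C c by (auto simp: scalar_prod_smult[of _ m] power2_eq_square)
  qed
  also have "\<dots> = (\<Sum>j\<in>{..<N} \<inter> {..<m}. (singular_value Y (j + 1))\<^sup>2 * ((C *\<^sub>v col U j) \<bullet> (C *\<^sub>v col U j)))"
    by (auto simp: sum.inter_restrict intro!: sum.cong)
  also have "\<dots> = (\<Sum>j<m. (singular_value Y (j + 1))\<^sup>2 * ((C *\<^sub>v col U j) \<bullet> (C *\<^sub>v col U j)))"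
    using Y by (intro sum.mono_neutral_left) (auto simp: singular_value_def)
  finally show ?thesis by (simp add: C_def[symmetric] res)
qed

text \<open>
The difference between a weighted sum and the claimed minimum can be written as a sum of
\<open>(\<mu> i - l) * (e i - p i)\<close>, where \<open>e\<close> is the indicator of the first \<^term>\<open>r\<close> indices: shifting by \<open>l\<close>
changes nothing because \<open>e\<close> and \<^term>\<open>p\<close> have the same total. Each summand is nonnegative. When all
of them vanish, the strict inequality on the tail forces \<^term>\<open>p\<close> to be zero there, and then its
total forces it to be one on the head.
\<close>
lemma weighted_sum_lower_bound:
  fixes \<mu> p :: "nat \<Rightarrow> real"
  assumes "r \<le> m" and head: "\<And>i. i < r \<Longrightarrow> l \<le> \<mu> i"
    and tail: "\<And>i. r \<le> i \<Longrightarrow> i < m \<Longrightarrow> \<mu> i < l"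
    and p: "\<And>i. i < m \<Longrightarrow> 0 \<le> p i" "\<And>i. i < m \<Longrightarrow> p i \<le> 1" "(\<Sum>i<m. p i) = real r"
  shows "(\<Sum>i=r..<m. \<mu> i) \<le> (\<Sum>i<m. \<mu> i * (1 - p i))"
    and "(\<Sum>i<m. \<mu> i * (1 - p i)) = (\<Sum>i=r..<m. \<mu> i) \<longleftrightarrow> (\<forall>i<m. p i = (if i < r then 1 else 0))"
proof -
  define e where "e i = (if i < r then 1 else 0 :: real)" for i
  have "{..<m} \<inter> {..<r} = {..<r}" using \<open>r \<le> m\<close> by auto
  then have sum_e: "(\<Sum>i<m. e i) = real r"
    by (simp add: e_def sum.If_cases lessThan_def[symmetric])
  have "{..<m} \<inter> - {..<r} = {r..<m}" by auto
  then have "(\<Sum>i=r..<m. \<mu> i) = (\<Sum>i<m. \<mu> i * (1 - e i))"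
    by (simp add: e_def if_distrib sum.If_cases lessThan_def[symmetric] cong: if_cong)
  then have "(\<Sum>i<m. \<mu> i * (1 - p i)) - (\<Sum>i=r..<m. \<mu> i) = (\<Sum>i<m. \<mu> i * (e i - p i))"
    by (simp add: sum_subtractf[symmetric] algebra_simps)
  also have "\<dots> = (\<Sum>i<m. \<mu> i * (e i - p i)) - l * (\<Sum>i<m. e i - p i)"
    by (simp add: sum_subtractf sum_e p(3))
  also have "\<dots> = (\<Sum>i<m. (\<mu> i - l) * (e i - p i))"
    by (simp add: sum_distrib_left sum_subtractf[symmetric] algebra_simps)
  finally have diff: "(\<Sum>i<m. \<mu> i * (1 - p i)) - (\<Sum>i=r..<m. \<mu> i) = (\<Sum>i<m. (\<mu> i - l) * (e i - p i))" .
  have nonneg: "0 \<le> (\<mu> i - l) * (e i - p i)" if "i < m" for i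
    using that head[of i] tail[of i] p(1,2)[of i]
    by (cases "i < r") (auto simp: e_def mult_nonpos_nonneg mult_nonneg_nonpos zero_le_mult_iff mult_le_0_iff)
  then show "(\<Sum>i=r..<m. \<mu> i) \<le> (\<Sum>i<m. \<mu> i * (1 - p i))"
    using sum_nonneg[of "{..<m}" "\<lambda>i. (\<mu> i - l) * (e i - p i)"] diff by simp
  show "(\<Sum>i<m. \<mu> i * (1 - p i)) = (\<Sum>i=r..<m. \<mu> i) \<longleftrightarrow> (\<forall>i<m. p i = (if i < r then 1 else 0))"
  proof
    assume "(\<Sum>i<m. \<mu> i * (1 - p i)) = (\<Sum>i=r..<m. \<mu> i)"
    then have "(\<Sum>i<m. (\<mu> i - l) * (e i - p i)) = 0" using diff by simp
    then have z: "(\<mu> i - l) * (e i - p i) = 0" if "i < m" for i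
      using sum_nonneg_eq_0_iff[of "{..<m}" "\<lambda>i. (\<mu> i - l) * (e i - p i)"] nonneg that by simp
    have p0: "e i = p i" if "r \<le> i" "i < m" for i
      using z[of i] tail[of i] that by auto
    have "0 \<le> e i - p i" if "i < m" for i
      using p0[of i] p(2)[of i] that by (cases "i < r") (auto simp: e_def)
    moreover have "(\<Sum>i<m. e i - p i) = 0" using sum_e p(3) by (simp add: sum_subtractf)
    ultimately have "e i - p i = 0" if "i < m" for i
      using sum_nonneg_eq_0_iff[of "{..<m}" "\<lambda>i. e i - p i"] that by simp
    then show "\<forall>i<m. p i = (if i < r then 1 else 0)" by (simp add: e_def)
  next
    assume "\<forall>i<m. p i = (if i < r then 1 else 0)"
    then have "(\<Sum>i<m. (\<mu> i - l) * (e i - p i)) = 0" by (simp add: e_def)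
    then show "(\<Sum>i<m. \<mu> i * (1 - p i)) = (\<Sum>i=r..<m. \<mu> i)" using diff by simp
  qed
qed

text \<open>
If the projector of \<^term>\<open>V\<close> fixes the columns of \<^term>\<open>Z\<close>, the square matrix \<open>V\<^sup>T Z\<close> of coordinates is
orthogonal, so both matrices are bases of the same space.
\<close>
lemma orthonormal_same_projector:
  assumes V: "orthonormal_cols m r V" and Z: "orthonormal_cols m r Z"
    and fixed: "V * (transpose_mat V * Z) = Z"
  shows "V * transpose_mat V = Z * transpose_mat Z"
proof -
  define M where "M = transpose_mat V * Z"
  have c: "V \<in> carrier_mat m r" "Z \<in> carrier_mat m r" "M \<in> carrier_mat r r"
    using V Z by (auto simp: orthonormal_cols_def M_def)
  have "transpose_mat M * M = transpose_mat Z * V * M"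
    using c by (simp add: M_def transpose_mult[of _ r m _ r])
  also have "\<dots> = transpose_mat Z * Z"
    using c fixed by (simp add: M_def[symmetric] assoc_mult_mat[of _ r m _ r])
  also have "\<dots> = 1\<^sub>m r" using Z by (simp add: orthonormal_cols_def)
  finally have "orthonormal_cols r r M" using c by (simp add: orthonormal_cols_def)
  then have MM: "M * transpose_mat M = 1\<^sub>m r" by (rule square_orthonormal_cols)
  have "Z * transpose_mat Z = V * M * transpose_mat (V * M)"
    using fixed by (simp add: M_def)
  also have "\<dots> = V * (M * transpose_mat M) * transpose_mat V"
    using c by (simp add: transpose_mult[of _ m r _ r] assoc_mult_mat[of _ m r _ r _ r]
      assoc_mult_mat[of _ m r _ r _ m] assoc_mult_mat[of _ r r _ r _ m])
  also have "\<dots> = V * transpose_mat V" using c MM by simp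
  finally show ?thesis ..
qed

lemma first_cols_carrier:
  assumes "U \<in> carrier_mat m N" "r \<le> N"
  shows "first_cols r U \<in> carrier_mat m r"
  using assms by (auto simp: first_cols_def)

lemma col_first_cols:
  assumes "U \<in> carrier_mat m N" "r \<le> N" "j < r"
  shows "col (first_cols r U) j = col U j"
  using assms unfolding first_cols_def by (subst col_mat_of_cols) auto

lemma first_cols_orthonormal:
  assumes U: "orthonormal_cols m N U" and r: "r \<le> N"
  shows "orthonormal_cols m r (first_cols r U)"
proof -
  have c: "U \<in> carrier_mat m N" using U by (simp add: orthonormal_cols_def)
  show ?thesis
    using U r by (simp add: orthonormal_cols_iff_col[OF c] col_first_cols[OF c r]
        orthonormal_cols_iff_col[OF first_cols_carrier[OF c r]])
qed

lemma transpose_mult_vec_norm_sq: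
  fixes V :: "real mat"
  assumes "V \<in> carrier_mat m r" "u \<in> carrier_vec m"
  shows "(transpose_mat V *\<^sub>v u) \<bullet> (transpose_mat V *\<^sub>v u) = u \<bullet> ((V * transpose_mat V) *\<^sub>v u)"
  using transpose_vec_mult_scalar[OF assms(1) _ assms(2), of "transpose_mat V *\<^sub>v u"] assms by simp

text \<open>
A unit vector lies in the column space of \<^term>\<open>V\<close> exactly when its coordinate vector still has
length one. The condition thus makes the projector fix the first \<^term>\<open>r\<close> columns of \<^term>\<open>U\<close>,
which form a basis of the other space.
\<close>
lemma projector_eq_leading_iff:
  assumes U: "orthonormal_cols m m U" and V: "orthonormal_cols m r V" and r: "r \<le> m"
  defines "Z \<equiv> first_cols r U"
  shows "V * transpose_mat V = Z * transpose_mat Z \<longleftrightarrow>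
    (\<forall>i<m. (transpose_mat V *\<^sub>v col U i) \<bullet> (transpose_mat V *\<^sub>v col U i) = (if i < r then 1 else 0))"
proof -
  have Z: "orthonormal_cols m r Z" using first_cols_orthonormal[OF U r] by (simp add: Z_def)
  have c: "U \<in> carrier_mat m m" "V \<in> carrier_mat m r" "Z \<in> carrier_mat m r"
    using U V Z by (auto simp: orthonormal_cols_def)
  have colZ: "col Z j = col U j" if "j < r" for j
    using col_first_cols[OF c(1) r that] by (simp add: Z_def)
  show ?thesis
  proof
    assume eq: "V * transpose_mat V = Z * transpose_mat Z"
    show "\<forall>i<m. (transpose_mat V *\<^sub>v col U i) \<bullet> (transpose_mat V *\<^sub>v col U i) = (if i < r then 1 else 0)"
    proof (intro allI impI)
      fix i assume i: "i < m"
      have u: "col U i \<in> carrier_vec m" using c(1) col_dim[of U i] by simp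
      have "(transpose_mat V *\<^sub>v col U i) \<bullet> (transpose_mat V *\<^sub>v col U i)
          = (transpose_mat Z *\<^sub>v col U i) \<bullet> (transpose_mat Z *\<^sub>v col U i)"
        using transpose_mult_vec_norm_sq[OF c(2) u] transpose_mult_vec_norm_sq[OF c(3) u]
        unfolding eq by simp
      also have "transpose_mat Z *\<^sub>v col U i = (if i < r then unit_vec r i else 0\<^sub>v r)"
        using c colZ U i r by (intro eq_vecI) (auto simp: orthonormal_cols_iff_col)
      finally show "(transpose_mat V *\<^sub>v col U i) \<bullet> (transpose_mat V *\<^sub>v col U i) = (if i < r then 1 else 0)"
        by simp
    qed
  next
    assume p: "\<forall>i<m. (transpose_mat V *\<^sub>v col U i) \<bullet> (transpose_mat V *\<^sub>v col U i) = (if i < r then 1 else 0)"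
    have "V * (transpose_mat V * Z) = Z"
    proof (rule mat_col_eqI)
      fix j assume "j < dim_col Z"
      then have j: "j < r" "j < m" using c r by auto
      define u where "u = col U j"
      have u: "u \<in> carrier_vec m" using c(1) col_dim[of U j] by (simp add: u_def)
      have w: "V *\<^sub>v (transpose_mat V *\<^sub>v u) \<in> carrier_vec m" using c u by simp
      have "u \<bullet> u = 1" using U c j by (simp add: u_def orthonormal_cols_iff_col)
      then have "((1\<^sub>m m - V * transpose_mat V) *\<^sub>v u) \<bullet> ((1\<^sub>m m - V * transpose_mat V) *\<^sub>v u) = 0"
        using projection_residual_norm_sq[OF V u] p j by (simp add: u_def)
      then have "u - V *\<^sub>v (transpose_mat V *\<^sub>v u) = 0\<^sub>v m"
        using projector_mult_vec[OF c(2) u] real_scalar_prod_self_eq_0[of _ m] u w by simp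
      then have "(u - V *\<^sub>v (transpose_mat V *\<^sub>v u)) $ i = 0" if "i < m" for i using that by simp
      then have "V *\<^sub>v (transpose_mat V *\<^sub>v u) = u"
        using u w c by (intro eq_vecI) auto
      moreover have "col (V * (transpose_mat V * Z)) j = V *\<^sub>v (transpose_mat V *\<^sub>v col Z j)"
      proof -
        have VZ: "transpose_mat V * Z \<in> carrier_mat r r" using c by simp
        have "transpose_mat V \<in> carrier_mat r m" using c by simp
        then show ?thesis using col_mult2[OF c(2) VZ j(1)] col_mult2[OF _ c(3) j(1)] by metis
      qed
      ultimately show "col (V * (transpose_mat V * Z)) j = col Z j"
        using colZ[OF j(1)] by (simp add: u_def)
    qed (use c in auto)
    then show "V * transpose_mat V = Z * transpose_mat Z"
      by (rule orthonormal_same_projector[OF V Z])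
  qed
qed

text \<open>
The previous bounds apply with \<open>p i\<close> the squared length of the projection of the \<open>i\<close>-th left
singular vector. All left singular vectors together form an orthonormal basis, so these numbers add
up to the squared Frobenius norm of \<^term>\<open>V\<close>, which is \<^term>\<open>r\<close>.
\<close>
lemma projection_error_minimum:
  assumes svd: "is_svd Y U S W" and Y: "Y \<in> carrier_mat m N" and V: "orthonormal_cols m r V"
    and r: "0 < r" "r \<le> m" and gap: "singular_value Y r > singular_value Y (r + 1)"
  defines "Z \<equiv> first_cols r U"
  shows "(\<Sum>i=r..<m. (singular_value Y (i + 1))\<^sup>2) \<le> (frob_norm ((1\<^sub>m m - V * transpose_mat V) * Y))\<^sup>2"
    and "(frob_norm ((1\<^sub>m m - V * transpose_mat V) * Y))\<^sup>2 = (\<Sum>i=r..<m. (singular_value Y (i + 1))\<^sup>2)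
      \<longleftrightarrow> V * transpose_mat V = Z * transpose_mat Z"
proof -
  have U: "orthonormal_cols m m U" using svd Y by (auto simp: is_svd_def)
  have c: "U \<in> carrier_mat m m" "V \<in> carrier_mat m r"
    using U V by (auto simp: orthonormal_cols_def)
  define p where "p i = (transpose_mat V *\<^sub>v col U i) \<bullet> (transpose_mat V *\<^sub>v col U i)" for i
  define \<mu> where "\<mu> i = (singular_value Y (i + 1))\<^sup>2" for i
  have head: "(singular_value Y r)\<^sup>2 \<le> \<mu> i" if "i < r" for i
    unfolding \<mu>_def using that singular_value_antimono[of "i + 1" r Y] singular_value_nonneg[of Y r]
    by (intro power_mono) auto
  have tail: "\<mu> i < (singular_value Y r)\<^sup>2" if "r \<le> i" for i
    unfolding \<mu>_def using that singular_value_antimono[of "r + 1" "i + 1" Y] gap singular_value_nonneg[of Y "i + 1"]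
    by (intro power_strict_mono) auto
  have p0: "0 \<le> p i" for i by (simp add: p_def real_scalar_prod_ge_0)
  have p1: "p i \<le> 1" if "i < m" for i
    using projection_residual_norm_sq[OF V, of "col U i"] c U that
      real_scalar_prod_ge_0[of "(1\<^sub>m m - V * transpose_mat V) *\<^sub>v col U i"]
    by (simp add: p_def orthonormal_cols_iff_col)
  have "(\<Sum>i<m. p i) = (frob_norm (transpose_mat V * U))\<^sup>2"
    using c by (simp add: frob_norm_sq_cols p_def)
  also have "\<dots> = real r"
    using frob_norm_mult_transpose_orthonormal[OF square_orthonormal_cols(2)[OF U], of "transpose_mat V" r] c
      frob_norm_sq_orthonormal_cols[OF V] by (simp add: frob_norm_transpose)
  finally have psum: "(\<Sum>i<m. p i) = real r" .
  note err = projection_error_svd[OF svd Y V, folded p_def \<mu>_def]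
  note bound = weighted_sum_lower_bound[where l = "(singular_value Y r)\<^sup>2" and \<mu> = \<mu>, OF r(2) head tail p0 p1 psum]
  show "(\<Sum>i=r..<m. (singular_value Y (i + 1))\<^sup>2) \<le> (frob_norm ((1\<^sub>m m - V * transpose_mat V) * Y))\<^sup>2"
    unfolding err using bound(1) by (simp add: \<mu>_def)
  show "(frob_norm ((1\<^sub>m m - V * transpose_mat V) * Y))\<^sup>2 = (\<Sum>i=r..<m. (singular_value Y (i + 1))\<^sup>2)
      \<longleftrightarrow> V * transpose_mat V = Z * transpose_mat Z"
    unfolding err using bound(2) projector_eq_leading_iff[OF U V r(2)]
    by (simp add: \<mu>_def p_def Z_def)
qed

section \<open>The Poisson matrix\<close>

lemma poisson_mat_carrier [simp]: "poisson_mat m \<in> carrier_mat (2 * m) (2 * m)"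
  unfolding poisson_mat_def mult_2 by (intro four_block_carrier_mat) auto

lemma poisson_mat_dim [simp]: "dim_row (poisson_mat m) = 2 * m" "dim_col (poisson_mat m) = 2 * m"
  by (simp_all add: poisson_mat_def)

lemma poisson_mat_index:
  assumes "i < 2 * m" "j < 2 * m"
  shows "poisson_mat m $$ (i, j) = (if j = i + m then 1 else if i = j + m then -1 else 0)"
  using assms by (auto simp: poisson_mat_def)

lemma poisson_mat_transpose: "transpose_mat (poisson_mat m) = - poisson_mat m"
  by (rule eq_matI) (auto simp: poisson_mat_index)

lemma poisson_mat_sq: "poisson_mat m * poisson_mat m = - 1\<^sub>m (2 * m)"
proof -
  have "poisson_mat m * poisson_mat m
      = four_block_mat (- 1\<^sub>m m) (0\<^sub>m m m) (0\<^sub>m m m) (- 1\<^sub>m m)"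
    unfolding poisson_mat_def
    by (subst mult_four_block_mat[of _ m m _ m _ m _ _ m _ m])
      (auto simp: intro!: cong_four_block_mat eq_matI)
  also have "\<dots> = - 1\<^sub>m (2 * m)" by (rule eq_matI) auto
  finally show ?thesis .
qed

lemma poisson_mat_orthonormal: "orthonormal_cols (2 * m) (2 * m) (poisson_mat m)"
  by (simp add: orthonormal_cols_def poisson_mat_transpose poisson_mat_sq)

section \<open>Errors as sums over columns\<close>

lemma cols_mult_mat:
  assumes "C \<in> carrier_mat r m" "M \<in> carrier_mat m N"
  shows "cols (C * M) = map ((*\<^sub>v) C) (cols M)"
  using assms by (intro nth_equalityI) auto

lemma frob_norm_sq_sum_list_cols: "(frob_norm A)\<^sup>2 = (\<Sum>v\<leftarrow>cols A. v \<bullet> v)"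
  by (simp add: frob_norm_sq_cols cols_def o_def sum_list_distinct_conv_sum_set atLeast0LessThan)

lemma frob_norm_uminus: "frob_norm (- A) = frob_norm A"
  by (simp add: frob_norm_def)

lemma cols_append_cols:
  assumes "A \<in> carrier_mat m a" "B \<in> carrier_mat m b"
  shows "cols (append_cols A B) = cols A @ cols B"
  using assms cols_dim[of A] cols_dim[of B] unfolding append_cols_def
  by (intro cols_mat_of_cols) auto

lemma append_cols_carrier:
  assumes "A \<in> carrier_mat m a" "B \<in> carrier_mat m b"
  shows "append_cols A B \<in> carrier_mat m (a + b)"
  using assms unfolding append_cols_def by (intro carrier_matI) auto

lemma frob_norm_sq_mult_append_cols:
  assumes "C \<in> carrier_mat r m" "A \<in> carrier_mat m a" "B \<in> carrier_mat m b"
  shows "(frob_norm (C * append_cols A B))\<^sup>2 = (frob_norm (C * A))\<^sup>2 + (frob_norm (C * B))\<^sup>2"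
  using assms append_cols_carrier[OF assms(2,3)]
  by (simp add: frob_norm_sq_sum_list_cols cols_mult_mat[of _ r m] cols_append_cols[of _ m])

text \<open>
Both sides add up the squared entries of the product, once as a matrix and once column by column.
\<close>
lemma projection_error_eq_pod_error:
  assumes "C \<in> carrier_mat r m" "Y \<in> carrier_mat m N"
  shows "(frob_norm (C * Y))\<^sup>2 = (\<Sum>y\<leftarrow>cols Y. (euclid_norm (C *\<^sub>v y))\<^sup>2)"
  using assms
  by (simp add: frob_norm_sq_sum_list_cols cols_mult_mat[of _ r m] euclid_norm_def
      real_scalar_prod_ge_0 o_def)

section \<open>Symplectic matrices with orthonormal columns\<close>

lemma mult_unit_vec_eq_col:
  fixes A :: "real mat"
  assumes "A \<in> carrier_mat r c" "j < c"
  shows "A *\<^sub>v unit_vec c j = col A j"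
  using col_mult2[OF assms(1) one_carrier_mat assms(2)] assms by simp

text \<open>
For every \<^term>\<open>x\<close> the vectors \<open>J V x\<close> and \<open>V K x\<close>, with the two Poisson matrices \<open>J\<close> and \<open>K\<close>, have
the length of \<^term>\<open>x\<close>. Symplecticity says that their inner product is its squared length, so
equality holds in the Cauchy-Schwarz inequality and the vectors agree.
\<close>
lemma symplectic_orthonormal_commute:
  assumes sp: "symplectic_mat n k V" and on: "orthonormal_cols (2 * n) (2 * k) V"
  shows "poisson_mat n * V = V * poisson_mat k"
proof -
  define J K where "J = poisson_mat n" and "K = poisson_mat k"
  have V: "V \<in> carrier_mat (2 * n) (2 * k)" using on by (simp add: orthonormal_cols_def)
  have J: "J \<in> carrier_mat (2 * n) (2 * n)" "orthonormal_cols (2 * n) (2 * n) J"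
    and K: "K \<in> carrier_mat (2 * k) (2 * k)" "orthonormal_cols (2 * k) (2 * k) K"
    by (simp_all add: J_def K_def poisson_mat_orthonormal)
  have VJV: "transpose_mat V * J * V = K" using sp by (simp add: symplectic_mat_def J_def K_def)
  have eq: "J *\<^sub>v (V *\<^sub>v x) = V *\<^sub>v (K *\<^sub>v x)" if x: "x \<in> carrier_vec (2 * k)" for x
  proof -
    define a b where "a = J *\<^sub>v (V *\<^sub>v x)" and "b = V *\<^sub>v (K *\<^sub>v x)"
    have Vx: "V *\<^sub>v x \<in> carrier_vec (2 * n)" and Kx: "K *\<^sub>v x \<in> carrier_vec (2 * k)"
      using V K x by simp_all
    have c: "a \<in> carrier_vec (2 * n)" "b \<in> carrier_vec (2 * n)"
      using J V Vx Kx by (simp_all add: a_def b_def)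
    have aa: "a \<bullet> a = x \<bullet> x"
      using orthonormal_cols_scalar_prod[OF J(2) Vx Vx] orthonormal_cols_scalar_prod[OF on x x]
      by (simp add: a_def)
    have bb: "b \<bullet> b = x \<bullet> x"
      using orthonormal_cols_scalar_prod[OF on Kx Kx] orthonormal_cols_scalar_prod[OF K(2) x x]
      by (simp add: b_def)
    have "transpose_mat V *\<^sub>v a = (transpose_mat V * J * V) *\<^sub>v x"
    proof -
      have "transpose_mat V * J \<in> carrier_mat (2 * k) (2 * n)" using V J by simp
      then show ?thesis
        using V J x Vx assoc_mult_mat_vec[of "transpose_mat V * J" "2 * k" "2 * n" V "2 * k" x]
          assoc_mult_mat_vec[of "transpose_mat V" "2 * k" "2 * n" J "2 * n" "V *\<^sub>v x"]
        by (simp add: a_def)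
    qed
    then have "a \<bullet> b = (K *\<^sub>v x) \<bullet> (K *\<^sub>v x)"
      using transpose_vec_mult_scalar[OF V Kx c(1)] VJV by (simp add: b_def)
    then have ab: "a \<bullet> b = x \<bullet> x" "b \<bullet> a = x \<bullet> x"
      using orthonormal_cols_scalar_prod[OF K(2) x x] comm_scalar_prod[OF c] by simp_all
    have "(a - b) \<bullet> (a - b) = 0"
      using c aa bb ab
      by (simp add: scalar_prod_minus_distrib[of _ "2 * n"] minus_scalar_prod_distrib[of _ "2 * n"])
    then have "a - b = 0\<^sub>v (2 * n)" using real_scalar_prod_self_eq_0[of "a - b" "2 * n"] c by simp
    then have "(a - b) $ i = 0" if "i < 2 * n" for i using that by simp
    then show ?thesis unfolding a_def[symmetric] b_def[symmetric] using c by (intro eq_vecI) auto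
  qed
  have "J * V = V * K"
  proof (rule mat_col_eqI)
    fix j assume "j < dim_col (V * K)"
    then have j: "j < 2 * k" using K by simp
    have "col (J * V) j = J *\<^sub>v (V *\<^sub>v unit_vec (2 * k) j)"
      using col_mult2[OF J(1) V j] V j by (simp add: mult_unit_vec_eq_col[OF V j])
    also have "\<dots> = V *\<^sub>v (K *\<^sub>v unit_vec (2 * k) j)" by (rule eq) simp
    also have "\<dots> = col (V * K) j"
      using col_mult2[OF V K(1) j] by (simp add: mult_unit_vec_eq_col[OF K(1) j])
    finally show "col (J * V) j = col (V * K) j" .
  qed (use J V K in auto)
  then show ?thesis by (simp add: J_def K_def)
qed

lemma symplectic_inverse_orthonormal:
  assumes sp: "symplectic_mat n k V" and on: "orthonormal_cols (2 * n) (2 * k) V"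
  shows "symplectic_inverse n k V = transpose_mat V"
proof -
  have V: "V \<in> carrier_mat (2 * n) (2 * k)" using on by (simp add: orthonormal_cols_def)
  have "transpose_mat (poisson_mat k) * transpose_mat V = transpose_mat (poisson_mat n * V)"
    unfolding symplectic_orthonormal_commute[OF sp on] by (rule transpose_mult[symmetric, OF V poisson_mat_carrier])
  also have "\<dots> = transpose_mat V * transpose_mat (poisson_mat n)"
    by (rule transpose_mult[OF poisson_mat_carrier V])
  finally have "symplectic_inverse n k V = transpose_mat V * transpose_mat (poisson_mat n) * poisson_mat n"
    by (simp add: symplectic_inverse_def)
  also have "\<dots> = transpose_mat V * (transpose_mat (poisson_mat n) * poisson_mat n)"
    by (rule assoc_mult_mat[of _ "2 * k" "2 * n" _ "2 * n" _ "2 * n"]) (use V in simp_all)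
  also have "\<dots> = transpose_mat V"
    using poisson_mat_orthonormal[of n] V by (simp add: orthonormal_cols_def)
  finally show ?thesis .
qed

lemma frob_norm_mult_poisson_of_commute:
  assumes C: "C \<in> carrier_mat (2 * n) (2 * n)" and X: "X \<in> carrier_mat (2 * n) N"
    and comm: "C * poisson_mat n = poisson_mat n * C"
  shows "frob_norm (C * (poisson_mat n * X)) = frob_norm (C * X)"
proof -
  have "C * (poisson_mat n * X) = poisson_mat n * (C * X)"
    using assoc_mult_mat[OF C poisson_mat_carrier X] assoc_mult_mat[OF poisson_mat_carrier C X] comm
    by simp
  then show ?thesis
    using frob_norm_orthonormal_mult[OF poisson_mat_orthonormal, of "C * X" n N] C X by simp
qed

lemma residual_projector_carrier:
  "V \<in> carrier_mat m r \<Longrightarrow> 1\<^sub>m m - V * transpose_mat V \<in> carrier_mat m (m :: nat)"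
  by (intro carrier_matI) simp_all

lemma residual_projector_commute:
  fixes P A :: "real mat"
  assumes "P \<in> carrier_mat m m" "A \<in> carrier_mat m m" "P * A = A * P"
  shows "(1\<^sub>m m - P) * A = A * (1\<^sub>m m - P)"
  using assms by (simp add: minus_mult_distrib_mat[of _ m m _ _ m] mult_minus_distrib_mat[of _ m m _ m])

text \<open>
\<open>J\<close> passes through both factors: \<open>J V = V K\<close> transposes to \<open>V\<^sup>T J = K V\<^sup>T\<close> because both Poisson
matrices are skew.
\<close>
lemma symplectic_orthonormal_projector_commute:
  assumes sp: "symplectic_mat n k V" and on: "orthonormal_cols (2 * n) (2 * k) V"
  shows "V * transpose_mat V * poisson_mat n = poisson_mat n * (V * transpose_mat V)"
proof -
  define J K where "J = poisson_mat n" and "K = poisson_mat k"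
  have V: "V \<in> carrier_mat (2 * n) (2 * k)" using on by (simp add: orthonormal_cols_def)
  then have Vt: "transpose_mat V \<in> carrier_mat (2 * k) (2 * n)" by simp
  have J: "J \<in> carrier_mat (2 * n) (2 * n)" and K: "K \<in> carrier_mat (2 * k) (2 * k)"
    by (simp_all add: J_def K_def)
  have JV: "J * V = V * K" using symplectic_orthonormal_commute[OF sp on] by (simp add: J_def K_def)
  have "transpose_mat (J * V) = transpose_mat (V * K)" by (simp add: JV)
  then have "- (transpose_mat V * J) = - (K * transpose_mat V)"
    using transpose_mult[OF J V] transpose_mult[OF V K] poisson_mat_transpose[of n, folded J_def]
      poisson_mat_transpose[of k, folded K_def] uminus_mult_right_mat[of "transpose_mat V" J]
      uminus_mult_left_mat[of K "transpose_mat V"] V J K by simp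
  then have VtJ: "transpose_mat V * J = K * transpose_mat V"
    by (metis uminus_uminus_mat)
  have "V * transpose_mat V * J = V * (K * transpose_mat V)"
    using assoc_mult_mat[OF V Vt J] VtJ by simp
  also have "\<dots> = J * V * transpose_mat V"
    using assoc_mult_mat[OF V K Vt] JV by simp
  also have "\<dots> = J * (V * transpose_mat V)" by (rule assoc_mult_mat[OF J V Vt])
  finally show ?thesis by (simp add: J_def)
qed

text \<open>
The residual projector commutes with the Poisson matrix, which preserves lengths. So the rotated
snapshots have the same error as the original ones.
\<close>
lemma psd_error_eq_half_projection_error:
  assumes sp: "symplectic_mat n k V" and on: "orthonormal_cols (2 * n) (2 * k) V"
    and X: "X \<in> carrier_mat (2 * n) N"
  shows "(frob_norm ((1\<^sub>m (2 * n) - V * symplectic_inverse n k V) * X))\<^sup>2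
    = (frob_norm ((1\<^sub>m (2 * n) - V * transpose_mat V) * rotated_augmentation n X))\<^sup>2 / 2"
proof -
  have V: "V \<in> carrier_mat (2 * n) (2 * k)" using on by (simp add: orthonormal_cols_def)
  define C where "C = 1\<^sub>m (2 * n) - V * transpose_mat V"
  have C: "C \<in> carrier_mat (2 * n) (2 * n)"
    unfolding C_def by (rule residual_projector_carrier[OF V])
  have P: "V * transpose_mat V \<in> carrier_mat (2 * n) (2 * n)" using V by simp
  have "C * poisson_mat n = poisson_mat n * C"
    unfolding C_def
    by (rule residual_projector_commute[OF P _ symplectic_orthonormal_projector_commute[OF sp on]]) simp
  note comm = frob_norm_mult_poisson_of_commute[OF C X this]
  have JX: "poisson_mat n * X \<in> carrier_mat (2 * n) N"
    by (rule mult_carrier_mat[OF poisson_mat_carrier X])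
  have "(frob_norm (C * rotated_augmentation n X))\<^sup>2 = 2 * (frob_norm (C * X))\<^sup>2"
    unfolding rotated_augmentation_def frob_norm_sq_mult_append_cols[OF C X JX] comm by simp
  then show ?thesis
    unfolding symplectic_inverse_orthonormal[OF sp on] C_def[symmetric] by simp
qed

section \<open>Symplectic bases of invariant subspaces\<close>

text \<open>
Rotating the subspace by \<^term>\<open>J\<close> has the same effect on the error as rotating the snapshots back.
That exchanges the two blocks of the augmented matrix up to a sign.
\<close>
lemma poisson_rotation_projection_error:
  assumes on: "orthonormal_cols (2 * n) r V" and X: "X \<in> carrier_mat (2 * n) N"
  defines "J \<equiv> poisson_mat n" and "Y \<equiv> rotated_augmentation n X"
  shows "orthonormal_cols (2 * n) r (J * V)"
    and "J * V * transpose_mat (J * V) = J * (V * transpose_mat V) * transpose_mat J"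
    and "(frob_norm ((1\<^sub>m (2 * n) - J * V * transpose_mat (J * V)) * Y))\<^sup>2
       = (frob_norm ((1\<^sub>m (2 * n) - V * transpose_mat V) * Y))\<^sup>2"
proof -
  have V: "V \<in> carrier_mat (2 * n) r" using on by (simp add: orthonormal_cols_def)
  then have Vt: "transpose_mat V \<in> carrier_mat r (2 * n)" by simp
  have J: "J \<in> carrier_mat (2 * n) (2 * n)" and Jt: "transpose_mat J \<in> carrier_mat (2 * n) (2 * n)"
    and J_on: "orthonormal_cols (2 * n) (2 * n) J"
    by (simp_all add: J_def poisson_mat_orthonormal)
  have JtJ: "transpose_mat J * J = 1\<^sub>m (2 * n)" and JJt: "J * transpose_mat J = 1\<^sub>m (2 * n)"
    using J_on square_orthonormal_cols(1)[OF J_on] by (simp_all add: orthonormal_cols_def)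
  have JV: "J * V \<in> carrier_mat (2 * n) r" using J V by simp
  show "orthonormal_cols (2 * n) r (J * V)" by (rule orthonormal_cols_mult[OF J_on on])
  define P where "P = V * transpose_mat V"
  have P: "P \<in> carrier_mat (2 * n) (2 * n)" using V by (simp add: P_def)
  have "J * V * transpose_mat (J * V) = J * V * (transpose_mat V * transpose_mat J)"
    by (simp add: transpose_mult[OF J V])
  also have "\<dots> = J * V * transpose_mat V * transpose_mat J"
    by (rule assoc_mult_mat[symmetric, OF JV Vt Jt])
  also have "J * V * transpose_mat V = J * P"
    unfolding P_def by (rule assoc_mult_mat[OF J V Vt])
  finally show proj: "J * V * transpose_mat (J * V) = J * (V * transpose_mat V) * transpose_mat J"
    by (simp add: P_def)
  define C where "C = 1\<^sub>m (2 * n) - P"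
  have C: "C \<in> carrier_mat (2 * n) (2 * n)" unfolding C_def by (rule minus_carrier_mat[OF P])
  define D where "D = 1\<^sub>m (2 * n) - J * V * transpose_mat (J * V)"
  have D: "D \<in> carrier_mat (2 * n) (2 * n)"
    unfolding D_def by (rule residual_projector_carrier[OF JV])
  have JC: "J * C \<in> carrier_mat (2 * n) (2 * n)" and JP: "J * P \<in> carrier_mat (2 * n) (2 * n)"
    using J C P by simp_all
  have "J * C * transpose_mat J = (J - J * P) * transpose_mat J"
    using mult_minus_distrib_mat[OF J one_carrier_mat P] J by (simp add: C_def)
  also have "\<dots> = D"
    using J Jt JP by (simp add: D_def proj P_def[symmetric] JJt minus_mult_distrib_mat[OF J JP Jt])
  finally have D_eq: "D = J * C * transpose_mat J" ..
  have "D * J = J * C * (transpose_mat J * J)"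
    unfolding D_eq by (rule assoc_mult_mat[OF JC Jt J])
  then have DJ: "D * J = J * C" using JtJ right_mult_one_mat[OF JC] by simp
  have "D * (J * X) = J * (C * X)"
    using assoc_mult_mat[OF D J X] assoc_mult_mat[OF J C X] DJ by simp
  then have 1: "frob_norm (D * (J * X)) = frob_norm (C * X)"
    using frob_norm_orthonormal_mult[OF J_on, of "C * X" N] C X by simp
  have JX: "J * X \<in> carrier_mat (2 * n) N" and JtX: "transpose_mat J * X \<in> carrier_mat (2 * n) N"
    using J X by simp_all
  have "D * X = J * C * (transpose_mat J * X)"
    unfolding D_eq by (rule assoc_mult_mat[OF JC Jt X])
  also have "\<dots> = J * (C * (transpose_mat J * X))" by (rule assoc_mult_mat[OF J C JtX])
  also have "C * (transpose_mat J * X) = - (C * (J * X))"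
    using J X C JX by (simp add: J_def poisson_mat_transpose)
  finally have "D * X = J * - (C * (J * X))" .
  then have 2: "frob_norm (D * X) = frob_norm (C * (J * X))"
    using frob_norm_orthonormal_mult[OF J_on, of "- (C * (J * X))" N] C JX
    by (simp add: frob_norm_uminus)
  have "(frob_norm (D * Y))\<^sup>2 = (frob_norm (C * Y))\<^sup>2"
    unfolding Y_def rotated_augmentation_def J_def[symmetric]
      frob_norm_sq_mult_append_cols[OF D X JX] frob_norm_sq_mult_append_cols[OF C X JX] 1 2 by simp
  then show "(frob_norm ((1\<^sub>m (2 * n) - J * V * transpose_mat (J * V)) * Y))\<^sup>2
       = (frob_norm ((1\<^sub>m (2 * n) - V * transpose_mat V) * Y))\<^sup>2"
    by (simp add: C_def D_def P_def)
qed

text \<open>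
Greedy construction. A unit vector \<open>e\<close> orthogonal to all pairs found so far is paired with its
image \<open>f\<close> under the transpose of \<^term>\<open>K\<close>. Skewness makes \<open>f\<close> orthogonal to \<open>e\<close> and, together with
orthogonality of \<^term>\<open>K\<close>, to all earlier pairs.
\<close>
lemma skew_orthogonal_darboux_basis:
  fixes K :: "real mat"
  assumes K: "orthonormal_cols N N K" and skew: "transpose_mat K = - K" and "2 * j \<le> N"
  shows "\<exists>es. length es = j \<and> orthonormal_list N (es @ map ((*\<^sub>v) (transpose_mat K)) es)"
  using \<open>2 * j \<le> N\<close>
proof (induction j)
  case 0
  then show ?case by (intro exI[of _ "[]"]) (simp add: orthonormal_list_def)
next
  case (Suc j)
  have Kc: "K \<in> carrier_mat N N" using K by (simp add: orthonormal_cols_def)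
  define f where "f = (*\<^sub>v) (transpose_mat K)"
  have f_car: "f v \<in> carrier_vec N" if "v \<in> carrier_vec N" for v using that Kc by (simp add: f_def)
  have ff: "f u \<bullet> f v = u \<bullet> v" if "u \<in> carrier_vec N" "v \<in> carrier_vec N" for u v
    unfolding f_def using orthonormal_cols_scalar_prod[OF square_orthonormal_cols(2)[OF K]] that .
  have skew': "f u \<bullet> v = - (u \<bullet> f v)" if uv: "u \<in> carrier_vec N" "v \<in> carrier_vec N" for u v
  proof -
    have "f u \<bullet> v = u \<bullet> (K *\<^sub>v v)"
      using transpose_vec_mult_scalar[OF Kc uv(2,1)] by (simp add: f_def)
    moreover have "f v = - (K *\<^sub>v v)" using Kc uv by (simp add: f_def skew)
    ultimately show ?thesis using uv Kc by simp
  qed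
  obtain es where es: "length es = j" "orthonormal_list N (es @ map f es)"
    using Suc by (auto simp: f_def)
  have es_car: "v \<in> carrier_vec N" if "v \<in> set es" for v
    using es(2) that by (auto simp: orthonormal_list_def)
  obtain e where e: "e \<in> carrier_vec N" "e \<bullet> e = 1" "\<And>v. v \<in> set (es @ map f es) \<Longrightarrow> v \<bullet> e = 0"
    using exists_unit_orthogonal[of "es @ map f es" N] es Suc.prems
    by (auto simp: orthonormal_list_def)
  have on1: "orthonormal_list N ((es @ map f es) @ [e])"
    by (rule orthonormal_list_snoc[OF es(2) e])
  have perp: "v \<bullet> f e = 0" if v: "v \<in> set ((es @ map f es) @ [e])" for v
  proof -
    consider "v \<in> set es" | u where "u \<in> set es" "v = f u" | "v = e" using v by auto
    then show ?thesis
    proof cases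
      case 1
      then have "f v \<bullet> e = 0" using e(3) by simp
      then show ?thesis using skew'[OF es_car[OF 1] e(1)] by simp
    next
      case 2
      then show ?thesis using ff[OF es_car e(1)] e(3) by simp
    next
      case 3
      have "f e \<bullet> e = e \<bullet> f e" by (rule comm_scalar_prod[OF f_car[OF e(1)] e(1)])
      then show ?thesis using skew'[OF e(1) e(1)] 3 by simp
    qed
  qed
  have "orthonormal_list N (((es @ map f es) @ [e]) @ [f e])"
    using orthonormal_list_snoc[OF on1 f_car[OF e(1)] _ perp] ff[OF e(1) e(1)] e(2) by simp
  then have "orthonormal_list N ((es @ [e]) @ map f (es @ [e]))"
    by (auto simp: orthonormal_list_def)
  then show ?case using es(1) by (intro exI[of _ "es @ [e]"]) (simp add: f_def)
qed

text \<open>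
In a Darboux basis with all vectors \<open>e\<close> listed before their partners \<open>f\<close>, the matrix sends \<open>f\<close> to
\<open>e\<close> and \<open>e\<close> to the negative of \<open>f\<close>, which is the action of the Poisson matrix.
\<close>
lemma skew_orthogonal_normal_form:
  fixes K :: "real mat"
  assumes K: "orthonormal_cols (2 * k) (2 * k) K" and skew: "transpose_mat K = - K"
  obtains Q where "orthonormal_cols (2 * k) (2 * k) Q" "transpose_mat Q * (K * Q) = poisson_mat k"
proof -
  define N where "N = 2 * k"
  have K: "orthonormal_cols N N K" using K by (simp add: N_def)
  have Kc: "K \<in> carrier_mat N N" using K by (simp add: orthonormal_cols_def)
  define f where "f = (*\<^sub>v) (transpose_mat K)"
  obtain es where es: "length es = k" "orthonormal_list N (es @ map f es)"
    using skew_orthogonal_darboux_basis[OF K skew, of k] by (auto simp: f_def N_def)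
  define Q where "Q = mat_of_cols N (es @ map f es)"
  have Q: "orthonormal_cols N N Q"
    using es unfolding Q_def by (simp add: orthonormal_list_iff_cols N_def mult_2)
  then have Qc: "Q \<in> carrier_mat N N" by (simp add: orthonormal_cols_def)
  have es_car: "es ! j \<in> carrier_vec N" "f (es ! j) \<in> carrier_vec N" if "j < k" for j
    using es that by (auto simp: orthonormal_list_def subset_iff)
  have col_lo: "col Q j = es ! j" if "j < k" for j
    unfolding Q_def using es(1) that es_car[OF that]
    by (subst col_mat_of_cols) (auto simp: nth_append)
  have col_hi: "col Q (j + k) = f (es ! j)" if "j < k" for j
    unfolding Q_def using es(1) that es_car[OF that]
    by (subst col_mat_of_cols) (auto simp: nth_append)
  have QQ: "col Q i \<bullet> col Q j = (if i = j then 1 else 0)" if "i < N" "j < N" for i j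
    using Q that by (simp add: orthonormal_cols_iff_col[OF Qc])
  have Qcol: "col Q i \<in> carrier_vec N" for i using Qc col_dim[of Q i] by simp
  have entry: "(transpose_mat Q * (K * Q)) $$ (i, j) = col Q i \<bullet> (K *\<^sub>v col Q j)"
    if "i < N" "j < N" for i j
    using that Qc Kc by simp
  have "transpose_mat Q * (K * Q) = poisson_mat k"
  proof (rule eq_matI)
    fix i j assume "i < dim_row (poisson_mat k)" "j < dim_col (poisson_mat k)"
    then have ij: "i < N" "j < N" by (simp_all add: N_def)
    show "(transpose_mat Q * (K * Q)) $$ (i, j) = poisson_mat k $$ (i, j)"
    proof (cases "j < k")
      case True
      have "K *\<^sub>v es ! j = - f (es ! j)"
        using skew es_car[OF True] Kc by (simp add: f_def)
      then have "col Q i \<bullet> (K *\<^sub>v col Q j) = - (col Q i \<bullet> col Q (j + k))"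
        unfolding col_lo[OF True] col_hi[OF True]
        using carrier_vecD[OF es_car(2)[OF True]] carrier_vecD[OF Qcol[of i]] by simp
      then show ?thesis
        using entry[OF ij] QQ[of i "j + k"] ij True by (simp add: poisson_mat_index N_def)
    next
      case False
      define l where "l = j - k"
      have l: "j = l + k" "l < k" using False ij by (auto simp: l_def N_def)
      have "K *\<^sub>v f (es ! l) = (K * transpose_mat K) *\<^sub>v es ! l"
        using Kc es_car[OF l(2)] by (simp add: f_def)
      then have "K *\<^sub>v col Q j = col Q l"
        using square_orthonormal_cols(1)[OF K] es_car[OF l(2)] by (simp add: l col_hi col_lo)
      then show ?thesis
        using entry[OF ij] QQ[of i l] ij l by (simp add: poisson_mat_index N_def)
    qed
  qed (use Qc Kc in \<open>simp_all add: N_def\<close>)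
  then show thesis using that Q by (simp add: N_def)
qed

lemma projector_right_orthonormal_mult:
  assumes V: "V \<in> carrier_mat m r" and Q: "orthonormal_cols r r Q"
  shows "V * Q * transpose_mat (V * Q) = V * transpose_mat V"
proof -
  have c: "Q \<in> carrier_mat r r" "transpose_mat V \<in> carrier_mat r m"
    "transpose_mat Q \<in> carrier_mat r r" "V * Q \<in> carrier_mat m r"
    using V Q by (auto simp: orthonormal_cols_def)
  have "V * Q * transpose_mat (V * Q) = V * Q * transpose_mat Q * transpose_mat V"
    unfolding transpose_mult[OF V c(1)] by (rule assoc_mult_mat[symmetric, OF c(4,3,2)])
  also have "V * Q * transpose_mat Q = V"
    using assoc_mult_mat[OF V c(1,3)] square_orthonormal_cols(1)[OF Q] V by simp
  finally show ?thesis .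
qed

text \<open>
The matrix of the Poisson map in the basis \<^term>\<open>V\<close> of the invariant subspace is skew and
orthogonal. A basis that brings it to normal form makes \<^term>\<open>V\<close> symplectic.
\<close>
lemma symplectic_basis_of_invariant_subspace:
  assumes V: "orthonormal_cols (2 * n) (2 * k) V"
    and inv: "poisson_mat n * (V * transpose_mat V) * transpose_mat (poisson_mat n) = V * transpose_mat V"
  obtains Q where "orthonormal_cols (2 * k) (2 * k) Q" "symplectic_mat n k (V * Q)"
proof -
  define J where "J = poisson_mat n"
  define K where "K = transpose_mat V * (J * V)"
  have c: "V \<in> carrier_mat (2 * n) (2 * k)" "transpose_mat V \<in> carrier_mat (2 * k) (2 * n)"
    using V by (auto simp: orthonormal_cols_def)
  have J: "J \<in> carrier_mat (2 * n) (2 * n)" "transpose_mat J \<in> carrier_mat (2 * n) (2 * n)"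
    and Jo: "orthonormal_cols (2 * n) (2 * n) J" and Jskew: "transpose_mat J = - J"
    by (simp_all add: J_def poisson_mat_orthonormal poisson_mat_transpose)
  have JJ: "transpose_mat J * J = 1\<^sub>m (2 * n)" using Jo by (simp add: orthonormal_cols_def)
  have JV: "J * V \<in> carrier_mat (2 * n) (2 * k)" using J c by simp
  have K: "K \<in> carrier_mat (2 * k) (2 * k)" unfolding K_def by (rule mult_carrier_mat[OF c(2) JV])
  have "transpose_mat K = transpose_mat (J * V) * V"
    unfolding K_def transpose_mult[OF c(2) JV] by simp
  also have "\<dots> = transpose_mat V * transpose_mat J * V" by (simp add: transpose_mult[OF J(1) c(1)])
  also have "\<dots> = transpose_mat V * (transpose_mat J * V)" by (rule assoc_mult_mat[OF c(2) J(2) c(1)])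
  also have "\<dots> = - K" using J c by (simp add: Jskew K_def)
  finally have Kskew: "transpose_mat K = - K" .
  define P where "P = V * transpose_mat V"
  have P: "P \<in> carrier_mat (2 * n) (2 * n)" using c by (simp add: P_def)
  have JP: "J * P \<in> carrier_mat (2 * n) (2 * n)" using J P by simp
  have "P * J = J * P * transpose_mat J * J" using inv by (simp add: P_def J_def)
  also have "\<dots> = J * P * (transpose_mat J * J)" by (rule assoc_mult_mat[OF JP J(2,1)])
  finally have PJ: "P * J = J * P" using JJ right_mult_one_mat[OF JP] by simp
  have PV: "P * V = V"
    using assoc_mult_mat[OF c(1,2,1)] V c by (simp add: P_def orthonormal_cols_def)
  have "V * K = P * (J * V)"
    unfolding K_def P_def by (rule assoc_mult_mat[symmetric, OF c(1,2) JV])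
  also have "\<dots> = P * J * V" by (rule assoc_mult_mat[symmetric, OF P J(1) c(1)])
  also have "\<dots> = J * (P * V)" unfolding PJ by (rule assoc_mult_mat[OF J(1) P c(1)])
  finally have VK: "V * K = J * V" by (simp add: PV)
  have "orthonormal_cols (2 * n) (2 * k) (J * V)" by (rule orthonormal_cols_mult[OF Jo V])
  then have "1\<^sub>m (2 * k) = transpose_mat (V * K) * (V * K)" by (simp add: orthonormal_cols_def VK)
  also have "\<dots> = transpose_mat K * transpose_mat V * (V * K)" by (simp add: transpose_mult[OF c(1) K])
  also have "\<dots> = transpose_mat K * (transpose_mat V * (V * K))"
    using K by (intro assoc_mult_mat[OF _ c(2) mult_carrier_mat[OF c(1) K]]) simp
  also have "transpose_mat V * (V * K) = K"
    using assoc_mult_mat[OF c(2,1) K] V K by (simp add: orthonormal_cols_def)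
  finally have "orthonormal_cols (2 * k) (2 * k) K" using K by (simp add: orthonormal_cols_def)
  from skew_orthogonal_normal_form[OF this Kskew] obtain Q
    where Q: "orthonormal_cols (2 * k) (2 * k) Q" and QKQ: "transpose_mat Q * (K * Q) = poisson_mat k"
    by blast
  have Qc: "Q \<in> carrier_mat (2 * k) (2 * k)" "transpose_mat Q \<in> carrier_mat (2 * k) (2 * k)"
    using Q by (auto simp: orthonormal_cols_def)
  have VQ: "V * Q \<in> carrier_mat (2 * n) (2 * k)" using c Qc by simp
  have JVQ: "J * V * Q \<in> carrier_mat (2 * n) (2 * k)" using JV Qc by simp
  have VtJ: "transpose_mat V * J \<in> carrier_mat (2 * k) (2 * n)" using J c by simp
  have "transpose_mat (V * Q) * J * (V * Q) = transpose_mat (V * Q) * (J * (V * Q))"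
    using VQ by (intro assoc_mult_mat[OF _ J(1) VQ]) simp
  also have "J * (V * Q) = J * V * Q" by (rule assoc_mult_mat[symmetric, OF J(1) c(1) Qc(1)])
  also have "transpose_mat (V * Q) * (J * V * Q) = transpose_mat Q * (transpose_mat V * (J * V * Q))"
    unfolding transpose_mult[OF c(1) Qc(1)] by (rule assoc_mult_mat[OF Qc(2) c(2) JVQ])
  also have "transpose_mat V * (J * V * Q) = K * Q"
    unfolding K_def by (rule assoc_mult_mat[symmetric, OF c(2) JV Qc(1)])
  finally have "symplectic_mat n k (V * Q)" using VQ QKQ by (simp add: symplectic_mat_def J_def)
  then show thesis using that Q by blast
qed

section \<open>Characterisation of the minimisers\<close>

lemma rotated_augmentation_carrier:
  assumes "X \<in> carrier_mat (2 * n) N"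
  shows "rotated_augmentation n X \<in> carrier_mat (2 * n) (N + N)"
  unfolding rotated_augmentation_def
  by (rule append_cols_carrier[OF assms mult_carrier_mat[OF poisson_mat_carrier assms]])

lemma is_arg_min_iff_attains:
  fixes f :: "'a \<Rightarrow> real"
  assumes lower: "\<And>x. Q x \<Longrightarrow> l \<le> f x" and attained: "Q z" "f z = l"
  shows "is_arg_min f Q x \<longleftrightarrow> Q x \<and> f x = l"
  using assms by (force simp: is_arg_min_def not_less)

lemma projection_minimizer_iff:
  assumes svd: "is_svd Y U S W" and Y: "Y \<in> carrier_mat (2 * n) N" and k: "0 < k" "k \<le> n"
    and gap: "singular_value Y (2 * k) > singular_value Y (2 * k + 1)"
  shows "projection_minimizer n k Y V \<longleftrightarrow>
    orthonormal_cols (2 * n) (2 * k) V \<and>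
    V * transpose_mat V = first_cols (2 * k) U * transpose_mat (first_cols (2 * k) U)"
proof -
  define Z where "Z = first_cols (2 * k) U"
  have U: "orthonormal_cols (2 * n) (2 * n) U" using svd Y by (simp add: is_svd_def)
  have r: "0 < 2 * k" "2 * k \<le> 2 * n" using k by simp_all
  have Z: "orthonormal_cols (2 * n) (2 * k) Z"
    unfolding Z_def by (rule first_cols_orthonormal[OF U r(2)])
  note min = projection_error_minimum[OF svd Y _ r gap, folded Z_def]
  have "projection_minimizer n k Y V \<longleftrightarrow> orthonormal_cols (2 * n) (2 * k) V \<and>
      (frob_norm ((1\<^sub>m (2 * n) - V * transpose_mat V) * Y))\<^sup>2 = (\<Sum>i=2 * k..<2 * n. (singular_value Y (i + 1))\<^sup>2)"
    unfolding projection_minimizer_def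
    by (rule is_arg_min_iff_attains[where z = Z]) (use min(1) min(2)[OF Z] Z in blast)+
  then show ?thesis unfolding Z_def[symmetric] using min(2) by blast
qed

text \<open>
By uniqueness of the optimal projector the optimal subspace is invariant, so every minimiser can
be rotated to a symplectic one. The symplectic problem, whose objective is half of the other one,
thus has half the unconstrained minimum as its minimum.
\<close>
lemma psd_orthonormal_minimizer_iff:
  assumes X: "X \<in> carrier_mat (2 * n) N" and k: "0 < k" "k \<le> n"
    and Y: "Y = rotated_augmentation n X"
    and gap: "singular_value Y (2 * k) > singular_value Y (2 * k + 1)"
  shows "psd_orthonormal_minimizer n k X V \<longleftrightarrow>
      symplectic_mat n k V \<and> projection_minimizer n k Y V"
    and "\<And>V. projection_minimizer n k Y V \<Longrightarrow>
      \<exists>Q. orthonormal_cols (2 * k) (2 * k) Q \<and> symplectic_mat n k (V * Q)"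
proof -
  obtain U S W where svd: "is_svd Y U S W" using svd_exists by blast
  define Z where "Z = first_cols (2 * k) U"
  define J where "J = poisson_mat n"
  define err where "err V = (frob_norm ((1\<^sub>m (2 * n) - V * transpose_mat V) * Y))\<^sup>2" for V
  have Yc: "Y \<in> carrier_mat (2 * n) (N + N)"
    unfolding Y by (rule rotated_augmentation_carrier[OF X])
  have U: "orthonormal_cols (2 * n) (2 * n) U" using svd Yc by (simp add: is_svd_def)
  have r: "0 < 2 * k" "2 * k \<le> 2 * n" using k by simp_all
  have Z: "orthonormal_cols (2 * n) (2 * k) Z"
    unfolding Z_def by (rule first_cols_orthonormal[OF U r(2)])
  note proj = projection_minimizer_iff[OF svd Yc k gap, folded Z_def]
  note min = projection_error_minimum[OF svd Yc _ r gap, folded Z_def err_def]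
  have "err (J * Z) = err Z" and JZ: "orthonormal_cols (2 * n) (2 * k) (J * Z)"
    using poisson_rotation_projection_error(1,3)[OF Z X] by (simp_all add: err_def Y J_def)
  then have "J * Z * transpose_mat (J * Z) = Z * transpose_mat Z"
    using min(2)[OF JZ] min(2)[OF Z] by simp
  then have inv: "J * (Z * transpose_mat Z) * transpose_mat J = Z * transpose_mat Z"
    using poisson_rotation_projection_error(2)[OF Z X] by (simp add: J_def)
  show rotate: "\<exists>Q. orthonormal_cols (2 * k) (2 * k) Q \<and> symplectic_mat n k (V * Q)"
    if "projection_minimizer n k Y V" for V
    using symplectic_basis_of_invariant_subspace[of n k V] that inv unfolding proj J_def by metis
  have "projection_minimizer n k Y Z" using proj Z by simp
  then obtain Q where Q: "orthonormal_cols (2 * k) (2 * k) Q" "symplectic_mat n k (Z * Q)"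
    using rotate by blast
  define l where "l = (\<Sum>i=2 * k..<2 * n. (singular_value Y (i + 1))\<^sup>2) / 2"
  have psd: "(frob_norm ((1\<^sub>m (2 * n) - V * symplectic_inverse n k V) * X))\<^sup>2 = err V / 2"
    if "symplectic_mat n k V \<and> orthonormal_cols (2 * n) (2 * k) V" for V
    using psd_error_eq_half_projection_error[OF _ _ X] that by (simp add: err_def Y)
  have Zc: "Z \<in> carrier_mat (2 * n) (2 * k)" using Z by (simp add: orthonormal_cols_def)
  have ZQ: "symplectic_mat n k (Z * Q) \<and> orthonormal_cols (2 * n) (2 * k) (Z * Q)"
    using Q orthonormal_cols_mult[OF Z] by blast
  have "err (Z * Q) / 2 = l"
    using min(2)[of "Z * Q"] ZQ projector_right_orthonormal_mult[OF Zc Q(1)] by (simp add: l_def)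
  then have "psd_orthonormal_minimizer n k X V \<longleftrightarrow>
      (symplectic_mat n k V \<and> orthonormal_cols (2 * n) (2 * k) V) \<and>
      (frob_norm ((1\<^sub>m (2 * n) - V * symplectic_inverse n k V) * X))\<^sup>2 = l"
    unfolding psd_orthonormal_minimizer_def
    by (intro is_arg_min_iff_attains[where z = "Z * Q"]) (use psd ZQ min(1) in \<open>auto simp: l_def\<close>)
  then show "psd_orthonormal_minimizer n k X V \<longleftrightarrow>
      symplectic_mat n k V \<and> projection_minimizer n k Y V"
    using psd min(2) proj by (auto simp: l_def)
qed

theorem proposition6:
  fixes n n\<^sub>s k :: nat and X Y :: "real mat"
  assumes "0 < n" and "0 < n\<^sub>s" and "0 < k" and "k \<le> n"
    and "X \<in> carrier_mat (2 * n) n\<^sub>s"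
    and "Y = rotated_augmentation n X"
    and "singular_value Y (2 * k) > singular_value Y (2 * k + 1)"
  shows
    "(\<forall>V. psd_orthonormal_minimizer n k X V \<longleftrightarrow>
          symplectic_mat n k V \<and> projection_minimizer n k Y V) \<and>
     (\<forall>V \<in> carrier_mat (2 * n) (2 * k).
          projection_minimizer n k Y V \<longleftrightarrow>
          (\<exists>Q. orthonormal_cols (2 * k) (2 * k) Q \<and> psd_orthonormal_minimizer n k X (V * Q))) \<and>
     (\<forall>V. projection_minimizer n k Y V \<longleftrightarrow> pod_minimizer n k Y V) \<and>
     (\<exists>U S W. is_svd Y U S W) \<and>
     (\<forall>U S W. is_svd Y U S W \<longrightarrow> projection_minimizer n k Y (first_cols (2 * k) U))"
proof (intro conjI allI ballI impI)
  have Yc: "Y \<in> carrier_mat (2 * n) (n\<^sub>s + n\<^sub>s)"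
    unfolding assms(6) by (rule rotated_augmentation_carrier[OF assms(5)])
  show svd_ex: "\<exists>U S W. is_svd Y U S W" by (rule svd_exists)
  then obtain U S W where svd: "is_svd Y U S W" by blast
  note proj = projection_minimizer_iff[OF _ Yc assms(3,4,7)]
  note psd = psd_orthonormal_minimizer_iff[OF assms(5,3,4,6,7)]
  show "psd_orthonormal_minimizer n k X V \<longleftrightarrow> symplectic_mat n k V \<and> projection_minimizer n k Y V" for V
    by (rule psd(1))
  show "projection_minimizer n k Y (first_cols (2 * k) U')" if svd': "is_svd Y U' S' W'" for U' S' W'
  proof -
    have "orthonormal_cols (2 * n) (2 * n) U'" using svd' Yc by (simp add: is_svd_def)
    then show ?thesis using proj[OF svd'] first_cols_orthonormal assms(4) by simp
  qed
  show "projection_minimizer n k Y V \<longleftrightarrow> pod_minimizer n k Y V" for V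
  proof -
    have "(frob_norm ((1\<^sub>m (2 * n) - V * transpose_mat V) * Y))\<^sup>2
        = (\<Sum>y\<leftarrow>cols Y. (euclid_norm ((1\<^sub>m (2 * n) - V * transpose_mat V) *\<^sub>v y))\<^sup>2)"
      if "orthonormal_cols (2 * n) (2 * k) V" for V
      using that Yc
      by (intro projection_error_eq_pod_error residual_projector_carrier) (auto simp: orthonormal_cols_def)
    then show ?thesis
      unfolding projection_minimizer_def pod_minimizer_def is_arg_min_def by metis
  qed
  show "projection_minimizer n k Y V \<longleftrightarrow>
      (\<exists>Q. orthonormal_cols (2 * k) (2 * k) Q \<and> psd_orthonormal_minimizer n k X (V * Q))"
    if V: "V \<in> carrier_mat (2 * n) (2 * k)" for V
  proof
    assume pm: "projection_minimizer n k Y V"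
    then obtain Q where Q: "orthonormal_cols (2 * k) (2 * k) Q" "symplectic_mat n k (V * Q)"
      using psd(2) by blast
    have "orthonormal_cols (2 * n) (2 * k) V" using pm proj[OF svd] by simp
    from orthonormal_cols_mult[OF this Q(1)] projector_right_orthonormal_mult[OF V Q(1)]
    have "projection_minimizer n k Y (V * Q)"
      using pm unfolding proj[OF svd] by metis
    then show "\<exists>Q. orthonormal_cols (2 * k) (2 * k) Q \<and> psd_orthonormal_minimizer n k X (V * Q)"
      using psd(1) Q by blast
  next
    assume "\<exists>Q. orthonormal_cols (2 * k) (2 * k) Q \<and> psd_orthonormal_minimizer n k X (V * Q)"
    then obtain Q where Q: "orthonormal_cols (2 * k) (2 * k) Q"
      and VQ: "projection_minimizer n k Y (V * Q)" using psd(1) by blast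
    have Qc: "Q \<in> carrier_mat (2 * k) (2 * k)" "transpose_mat Q \<in> carrier_mat (2 * k) (2 * k)"
      using Q by (auto simp: orthonormal_cols_def)
    have VQc: "V * Q \<in> carrier_mat (2 * n) (2 * k)" using V Qc by simp
    \<comment> \<open>Rotating back by the inverse of \<^term>\<open>Q\<close> recovers \<^term>\<open>V\<close>.\<close>
    have undo: "V * Q * transpose_mat Q = V"
      using assoc_mult_mat[OF V Qc] square_orthonormal_cols(1)[OF Q] V by simp
    have Qt: "orthonormal_cols (2 * k) (2 * k) (transpose_mat Q)"
      by (rule square_orthonormal_cols(2)[OF Q])
    have "orthonormal_cols (2 * n) (2 * k) (V * Q)" using VQ proj[OF svd] by simp
    from orthonormal_cols_mult[OF this Qt] projector_right_orthonormal_mult[OF VQc Qt]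
    show "projection_minimizer n k Y V"
      using VQ unfolding proj[OF svd] undo by metis
  qed
qed

end
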